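(* Let $F$ be a finite field of characteristic $p$ with $|F|=q=p^k$ and let $G=C_3 \times Q_8$. If $p>3$, then $$U(FG) \cong \begin{cases} C_{p^k-1}^{12} \times GL(2,F)^3, & \text{if } q \equiv 1 \text{ or } -5 \bmod 12;\\ C_{p^k-1}^4 \times C_{p^{2k}-1}^4 \times GL(2, F) \times GL(2, F_2), & \text{if } q \equiv -1 \text{ or } 5 \bmod 12.\end{cases}$$
   Context: $FG$ denotes the group algebra of a finite group $G$ over $F$, and $U(FG)$ its group of units. $C_n$ is the cyclic group of order $n$, $Q_8$ is the quaternion group of order $8$, and $H^m$ denotes the direct product of $m$ copies of a group $H$. $F_2$ denotes the extension field of $F$ of degree $2$ (so $|F_2|=q^2$). *)

theory Defs
  imports
    "HOL-Algebra.Elementary_Groups"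
    "HOL-Algebra.Product_Groups"
    "HOL-Algebra.Multiplicative_Group"
    "HOL-Algebra.Embedded_Algebras"
    "HOL-Number_Theory.Cong"
    "Jordan_Normal_Form.Matrix"
begin

text \<open>
  The additive order of \<open>\<one>\<close>. Since \<^const>\<open>group.ord\<close> is \<open>0\<close> on elements of infinite order,
  this is the usual characteristic.
\<close>

definition ring_char :: "('a, 'm) ring_scheme \<Rightarrow> nat" where
  "ring_char R = group.ord (add_monoid R) \<one>\<^bsub>R\<^esub>"

text \<open>
  The group algebra of a \<^emph>\<open>finite\<close> group: the element \<open>\<Sum>\<^sub>x f\<^sub>x x\<close> is represented by its coefficient
  function \<open>f\<close>, extensional on \<open>carrier G\<close>. (For infinite \<open>G\<close> one would have to add a finite support
  condition.)
\<close>

definition group_algebra ::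
    "('a, 'm) ring_scheme \<Rightarrow> ('g, 'n) monoid_scheme \<Rightarrow> ('g \<Rightarrow> 'a) ring" where
  "group_algebra R G =
    \<lparr>carrier = carrier G \<rightarrow>\<^sub>E carrier R,
     monoid.mult = (\<lambda>f g. \<lambda>x\<in>carrier G.
       \<Oplus>\<^bsub>R\<^esub>y\<in>carrier G. f y \<otimes>\<^bsub>R\<^esub> g (inv\<^bsub>G\<^esub> y \<otimes>\<^bsub>G\<^esub> x)),
     one = (\<lambda>x\<in>carrier G. if x = \<one>\<^bsub>G\<^esub> then \<one>\<^bsub>R\<^esub> else \<zero>\<^bsub>R\<^esub>),
     zero = (\<lambda>x\<in>carrier G. \<zero>\<^bsub>R\<^esub>),
     add = (\<lambda>f g. \<lambda>x\<in>carrier G. f x \<oplus>\<^bsub>R\<^esub> g x)\<rparr>"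

text \<open>
  The matrix product of \<^theory>\<open>Jordan_Normal_Form.Matrix\<close> uses type-class arithmetic on the entries,
  so the product over a ring given as a record is written out here.
\<close>

definition mat_monoid :: "nat \<Rightarrow> ('a, 'm) ring_scheme \<Rightarrow> 'a mat monoid" where
  "mat_monoid n R =
    \<lparr>carrier = {A \<in> carrier_mat n n. elements_mat A \<subseteq> carrier R},
     monoid.mult = (\<lambda>A B. mat n n (\<lambda>(i, j). \<Oplus>\<^bsub>R\<^esub>k\<in>{..<n}. A $$ (i, k) \<otimes>\<^bsub>R\<^esub> B $$ (k, j))),
     one = mat n n (\<lambda>(i, j). if i = j then \<one>\<^bsub>R\<^esub> else \<zero>\<^bsub>R\<^esub>)\<rparr>"

definition GL :: "nat \<Rightarrow> ('a, 'm) ring_scheme \<Rightarrow> 'a mat monoid" where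
  "GL n R = units_of (mat_monoid n R)"

definition group_power :: "('a, 'm) monoid_scheme \<Rightarrow> nat \<Rightarrow> (nat \<Rightarrow> 'a) monoid" where
  "group_power H m = product_group {..<m} (\<lambda>_. H)"

text \<open>\<open>(a, b, c, d)\<close> stands for the quaternion \<open>a + b i + c j + d k\<close>.\<close>

type_synonym int_quat = "int \<times> int \<times> int \<times> int"

fun quat_mult :: "int_quat \<Rightarrow> int_quat \<Rightarrow> int_quat" where
  "quat_mult (a1, b1, c1, d1) (a2, b2, c2, d2) =
    (a1 * a2 - b1 * b2 - c1 * c2 - d1 * d2,
     a1 * b2 + b1 * a2 + c1 * d2 - d1 * c2,
     a1 * c2 - b1 * d2 + c1 * a2 + d1 * b2,
     a1 * d2 + b1 * c2 - c1 * b2 + d1 * a2)"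

definition Q8 :: "int_quat monoid" where
  "Q8 =
    \<lparr>carrier = {(1, 0, 0, 0), (-1, 0, 0, 0), (0, 1, 0, 0), (0, -1, 0, 0),
                (0, 0, 1, 0), (0, 0, -1, 0), (0, 0, 0, 1), (0, 0, 0, -1)},
     monoid.mult = quat_mult,
     one = (1, 0, 0, 0)\<rparr>"

lemma quat_mult_assoc: "quat_mult (quat_mult x y) z = quat_mult x (quat_mult y z)"
  by (cases x; cases y; cases z) (simp add: algebra_simps)

lemma group_Q8: "group Q8"
proof (rule groupI)
  show "x \<otimes>\<^bsub>Q8\<^esub> y \<in> carrier Q8" if "x \<in> carrier Q8" "y \<in> carrier Q8" for x y
    using that by (simp add: Q8_def) (elim disjE; simp)
  show "\<exists>y\<in>carrier Q8. y \<otimes>\<^bsub>Q8\<^esub> x = \<one>\<^bsub>Q8\<^esub>" if "x \<in> carrier Q8" for x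
    using that by (simp add: Q8_def) (elim disjE; simp)
qed (auto simp: Q8_def quat_mult_assoc)

lemma order_Q8: "order Q8 = 8"
  by (simp add: Q8_def order_def)

text \<open>
  \<open>E\<close> is an extension field of \<open>F\<close> of degree \<open>n\<close>, up to identifying \<open>F\<close> with its image in \<open>E\<close>.
\<close>

definition field_extension_of_degree ::
    "nat \<Rightarrow> ('a, 'm) ring_scheme \<Rightarrow> ('b, 'n) ring_scheme \<Rightarrow> bool" where
  "field_extension_of_degree n F E \<longleftrightarrow>
    field E \<and> (\<exists>h \<in> Ring.ring_hom F E. ring.dimension E n (h ` carrier F) (carrier E))"

end

theory Submission
  imports Defs "HOL-Decision_Procs.Algebra_Aux"
begin

text \<open>
  The absolutely irreducible representations of \<open>C\<^sub>3 \<times> Q\<^sub>8\<close> are \<open>\<chi> \<otimes> \<lambda>\<close> and \<open>\<chi> \<otimes> \<rho>\<close>, where \<open>\<chi>\<close> runs over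
  the characters of \<open>C\<^sub>3\<close>, \<open>\<lambda>\<close> over the four characters of \<open>Q\<^sub>8\<close>, and \<open>\<rho>\<close> is the representation of
  degree two, which is defined over every finite field because \<open>-1\<close> is a sum of two squares there.
  If \<open>3\<close> divides \<open>q - 1\<close>, all of them are defined over \<open>F\<close> and together embed \<open>FG\<close> into
  \<open>(F\<^sup>4 \<times> M\<^sub>2(F))\<^sup>3\<close>. Otherwise the two nontrivial \<open>\<chi>\<close> are conjugate over \<open>F\<^sub>2\<close>, and the trivial one
  together with one of these embeds \<open>FG\<close> into \<open>(F\<^sup>4 \<times> M\<^sub>2(F)) \<times> (F\<^sub>2\<^sup>4 \<times> M\<^sub>2(F\<^sub>2))\<close>. Both targets have
  \<open>q\<^sup>2\<^sup>4\<close> elements, so that the embeddings are bijective, and it remains to take units.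
\<close>

section \<open>Isomorphisms of products and unit groups\<close>

text \<open>The condition modulo 12 is really one modulo 3. The residue modulo 4 would decide
  whether -1 is a square in F, but the degree-two representation only asks for a sum of two squares;
  hence 1 and -5, both 1 modulo 3, fall together, and so do -1 and 5, both 2 modulo 3. Since only
  unit groups are compared, the embeddings are handled as bijections that respect products and one,
  and source and targets as plain structures with a product. Additivity enters only in the proof of
  injectivity, through single coefficient functionals. Injectivity itself is an explicit Fourier
  inversion: on \<open>Q8\<close> a function is split into its even and odd part under x -> -x,
  which costs a division by 2, and on C_3 the characters are separated, which costs a division by 3.
  These two divisions are where p > 3 enters. Surjectivity is left to counting, so no inverse
  transform has to be written down.\<close>

lemma DirProd_cong:
  assumes "A \<cong> B" "C \<cong> D"
  shows "A \<times>\<times> C \<cong> B \<times>\<times> D"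
proof -
  obtain f g where "f \<in> iso A B" "g \<in> iso C D"
    using assms by (auto simp: is_iso_def)
  then have "map_prod f g \<in> iso (A \<times>\<times> C) (B \<times>\<times> D)"
    unfolding iso_def hom_def bij_betw_def
    by (simp add: map_prod_inj_on map_prod_surj_on mult_DirProd' Pi_iff mem_Times_iff)
  then show ?thesis by (rule is_isoI)
qed

lemma DirProd_interchange:
  "(A \<times>\<times> B) \<times>\<times> (C \<times>\<times> D) \<cong> A \<times>\<times> C \<times>\<times> B \<times>\<times> D"
proof (rule is_isoI)
  show "(\<lambda>((a, b), (c, d)). (a, c, b, d)) \<in> iso ((A \<times>\<times> B) \<times>\<times> (C \<times>\<times> D)) (A \<times>\<times> C \<times>\<times> B \<times>\<times> D)"
    by (auto simp: iso_def hom_def bij_betw_def inj_on_def image_iff DirProd_def)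
qed

lemma product_group_cong:
  assumes "\<And>i. i \<in> I \<Longrightarrow> G i \<cong> H i"
  shows "product_group I G \<cong> product_group I H"
proof -
  have "\<exists>h. h \<in> iso (G i) (H i)" if "i \<in> I" for i
    using assms[OF that] by (auto simp: is_iso_def)
  then obtain f where f: "\<And>i. i \<in> I \<Longrightarrow> f i \<in> iso (G i) (H i)"
    by metis
  then have hom: "\<And>i. i \<in> I \<Longrightarrow> f i \<in> hom (G i) (H i)"
    and bij: "\<And>i. i \<in> I \<Longrightarrow> bij_betw (f i) (carrier (G i)) (carrier (H i))"
    by (auto simp: iso_def)
  define g where "g i = inv_into (carrier (G i)) (f i)" for i
  have g: "g i (f i x) = x" if "i \<in> I" "x \<in> carrier (G i)" for i x
    using bij_betw_inv_into_left[OF bij] that by (simp add: g_def)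
  have g': "f i (g i y) = y" "g i y \<in> carrier (G i)" if "i \<in> I" "y \<in> carrier (H i)" for i y
    using bij_betw_inv_into_right[OF bij] bij_betwE[OF bij_betw_inv_into[OF bij]] that
    by (simp_all add: g_def)
  have "bij_betw (\<lambda>x. \<lambda>i\<in>I. f i (x i)) (\<Pi>\<^sub>E i\<in>I. carrier (G i)) (\<Pi>\<^sub>E i\<in>I. carrier (H i))"
  proof (rule bij_betw_byWitness[where f' = "\<lambda>y. \<lambda>i\<in>I. g i (y i)"])
    show "\<forall>x\<in>\<Pi>\<^sub>E i\<in>I. carrier (G i). (\<lambda>i\<in>I. g i ((\<lambda>i\<in>I. f i (x i)) i)) = x"
      by (auto simp: PiE_iff fun_eq_iff extensional_def g)
    show "\<forall>y\<in>\<Pi>\<^sub>E i\<in>I. carrier (H i). (\<lambda>i\<in>I. f i ((\<lambda>i\<in>I. g i (y i)) i)) = y"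
      by (auto simp: PiE_iff fun_eq_iff extensional_def g')
    show "(\<lambda>x. \<lambda>i\<in>I. f i (x i)) ` (\<Pi>\<^sub>E i\<in>I. carrier (G i)) \<subseteq> (\<Pi>\<^sub>E i\<in>I. carrier (H i))"
      using bij by (fastforce dest: bij_betwE simp: PiE_iff)
    show "(\<lambda>y. \<lambda>i\<in>I. g i (y i)) ` (\<Pi>\<^sub>E i\<in>I. carrier (H i)) \<subseteq> (\<Pi>\<^sub>E i\<in>I. carrier (G i))"
      by (auto simp: PiE_iff g')
  qed
  then have bij': "bij_betw (\<lambda>x. \<lambda>i\<in>I. f i (x i)) (carrier (product_group I G)) (carrier (product_group I H))"
    by simp
  have "(\<lambda>x. \<lambda>i\<in>I. f i (x i)) \<in> iso (product_group I G) (product_group I H)"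
    by (intro isoI homI bij' bij_betw_apply[OF bij'])
       (auto simp: hom_mult[OF hom] PiE_iff intro!: restrict_ext)
  then show ?thesis by (rule is_isoI)
qed

lemma group_power_cong: "G \<cong> H \<Longrightarrow> group_power G n \<cong> group_power H n"
  unfolding group_power_def by (rule product_group_cong)

lemma group_power_DirProd:
  "group_power (G \<times>\<times> H) n \<cong> group_power G n \<times>\<times> group_power H n"
proof (rule is_isoI)
  let ?f = "\<lambda>x. (\<lambda>i\<in>{..<n}. fst (x i), \<lambda>i\<in>{..<n}. snd (x i))"
  have "bij_betw ?f ({..<n} \<rightarrow>\<^sub>E carrier G \<times> carrier H)
      (({..<n} \<rightarrow>\<^sub>E carrier G) \<times> ({..<n} \<rightarrow>\<^sub>E carrier H))"
  proof (rule bij_betw_byWitness[where f' = "\<lambda>(y, z). \<lambda>i\<in>{..<n}. (y i, z i)"])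
    show "\<forall>x\<in>{..<n} \<rightarrow>\<^sub>E carrier G \<times> carrier H. (\<lambda>(y, z). \<lambda>i\<in>{..<n}. (y i, z i)) (?f x) = x"
      by (clarsimp simp: PiE_iff extensional_def intro!: ext)
    show "\<forall>yz\<in>({..<n} \<rightarrow>\<^sub>E carrier G) \<times> ({..<n} \<rightarrow>\<^sub>E carrier H).
        ?f ((\<lambda>(y, z). \<lambda>i\<in>{..<n}. (y i, z i)) yz) = yz"
      by (clarsimp simp: PiE_iff extensional_def) (intro conjI ext; simp)
    show "?f ` ({..<n} \<rightarrow>\<^sub>E carrier G \<times> carrier H)
        \<subseteq> ({..<n} \<rightarrow>\<^sub>E carrier G) \<times> ({..<n} \<rightarrow>\<^sub>E carrier H)"
      by (force simp: PiE_iff mem_Times_iff)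
    show "(\<lambda>(y, z). \<lambda>i\<in>{..<n}. (y i, z i)) ` (({..<n} \<rightarrow>\<^sub>E carrier G) \<times> ({..<n} \<rightarrow>\<^sub>E carrier H))
        \<subseteq> {..<n} \<rightarrow>\<^sub>E carrier G \<times> carrier H"
      by (clarsimp simp: PiE_iff)
  qed
  then have bij: "bij_betw ?f (carrier (group_power (G \<times>\<times> H) n))
      (carrier (group_power G n \<times>\<times> group_power H n))"
    by (simp add: group_power_def)
  show "?f \<in> iso (group_power (G \<times>\<times> H) n) (group_power G n \<times>\<times> group_power H n)"
    by (intro isoI homI bij bij_betw_apply[OF bij])
       (simp_all add: group_power_def mult_DirProd' cong: restrict_cong)
qed

lemma group_power_group_power:
  "group_power (group_power G m) n \<cong> group_power G (n * m)"
proof (rule is_isoI)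
  \<comment> \<open>Index pairs are flattened by division with remainder: k = i * m + j has quotient
    i < n and remainder j < m.\<close>
  let ?f = "\<lambda>x. \<lambda>k\<in>{..<n * m}. x (k div m) (k mod m)"
  have lt: "i * m + j < n * m" if "i < n" "j < m" for i j
  proof -
    have "i * m + j < Suc i * m" using that by simp
    also have "\<dots> \<le> n * m" using that by (intro mult_le_mono1) simp
    finally show ?thesis .
  qed
  have dm: "k div m < n" "k mod m < m" if "k < n * m" for k
  proof -
    have "m > 0" using that by (cases m) auto
    then show "k mod m < m" "k div m < n"
      using that by (auto simp: less_mult_imp_div_less)
  qed
  have "bij_betw ?f ({..<n} \<rightarrow>\<^sub>E ({..<m} \<rightarrow>\<^sub>E carrier G)) ({..<n * m} \<rightarrow>\<^sub>E carrier G)"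
  proof (rule bij_betw_byWitness[where f' = "\<lambda>y. \<lambda>i\<in>{..<n}. \<lambda>j\<in>{..<m}. y (i * m + j)"])
    show "\<forall>x\<in>{..<n} \<rightarrow>\<^sub>E ({..<m} \<rightarrow>\<^sub>E carrier G). (\<lambda>i\<in>{..<n}. \<lambda>j\<in>{..<m}. ?f x (i * m + j)) = x"
    proof
      fix x assume x: "x \<in> {..<n} \<rightarrow>\<^sub>E ({..<m} \<rightarrow>\<^sub>E carrier G)"
      show "(\<lambda>i\<in>{..<n}. \<lambda>j\<in>{..<m}. ?f x (i * m + j)) = x"
      proof (rule PiE_ext[OF _ x])
        show "(\<lambda>i\<in>{..<n}. \<lambda>j\<in>{..<m}. ?f x (i * m + j)) \<in> {..<n} \<rightarrow>\<^sub>E ({..<m} \<rightarrow>\<^sub>E carrier G)"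
          using x by (simp add: PiE_iff lt)
        show "(\<lambda>i\<in>{..<n}. \<lambda>j\<in>{..<m}. ?f x (i * m + j)) i = x i" if "i \<in> {..<n}" for i
          using that PiE_mem[OF x that] by (auto simp: PiE_iff extensional_def lt)
      qed
    qed
    show "\<forall>y\<in>{..<n * m} \<rightarrow>\<^sub>E carrier G. ?f (\<lambda>i\<in>{..<n}. \<lambda>j\<in>{..<m}. y (i * m + j)) = y"
    proof
      fix y assume y: "y \<in> {..<n * m} \<rightarrow>\<^sub>E carrier G"
      have "(\<lambda>i\<in>{..<n}. \<lambda>j\<in>{..<m}. y (i * m + j)) (k div m) (k mod m) = y k" if "k < n * m" for k
        using dm[OF that] by simp
      with y show "?f (\<lambda>i\<in>{..<n}. \<lambda>j\<in>{..<m}. y (i * m + j)) = y"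
        by (intro PiE_ext[OF _ y]) (simp_all add: PiE_iff)
    qed
    show "?f ` ({..<n} \<rightarrow>\<^sub>E ({..<m} \<rightarrow>\<^sub>E carrier G)) \<subseteq> {..<n * m} \<rightarrow>\<^sub>E carrier G"
      by (auto simp: PiE_iff dm)
    show "(\<lambda>y. \<lambda>i\<in>{..<n}. \<lambda>j\<in>{..<m}. y (i * m + j)) ` ({..<n * m} \<rightarrow>\<^sub>E carrier G)
        \<subseteq> {..<n} \<rightarrow>\<^sub>E ({..<m} \<rightarrow>\<^sub>E carrier G)"
      by (intro image_subsetI) (simp add: PiE_iff lt)
  qed
  then have bij: "bij_betw ?f (carrier (group_power (group_power G m) n)) (carrier (group_power G (n * m)))"
    by (simp add: group_power_def)
  show "?f \<in> iso (group_power (group_power G m) n) (group_power G (n * m))"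
    by (intro isoI homI bij bij_betw_apply[OF bij])
       (simp_all add: group_power_def dm cong: restrict_cong)
qed

text \<open>Injectivity of \<open>h\<close>, together with \<open>h\<close> sending one to one,
  reflects the equation x y = 1, so two-sided inverses correspond. Membership in \<open>iso\<close>
  speaks only of carriers and products; the image of one is therefore asked for separately. The
  structures are arbitrary because the group algebra and the matrix monoid enter only as carriers
  with a product and a one.\<close>

lemma units_of_cong:
  assumes h: "h \<in> iso A B" and one: "h \<one>\<^bsub>A\<^esub> = \<one>\<^bsub>B\<^esub>" "\<one>\<^bsub>A\<^esub> \<in> carrier A"
    and closed: "\<And>x y. x \<in> carrier A \<Longrightarrow> y \<in> carrier A \<Longrightarrow> x \<otimes>\<^bsub>A\<^esub> y \<in> carrier A"
  shows "units_of A \<cong> units_of B"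
proof (rule is_isoI)
  have hom: "\<And>x y. x \<in> carrier A \<Longrightarrow> y \<in> carrier A \<Longrightarrow> h (x \<otimes>\<^bsub>A\<^esub> y) = h x \<otimes>\<^bsub>B\<^esub> h y"
    and bij: "bij_betw h (carrier A) (carrier B)"
    using h by (auto simp: iso_def hom_def)
  have inj: "\<And>x y. x \<in> carrier A \<Longrightarrow> y \<in> carrier A \<Longrightarrow> h x = h y \<longleftrightarrow> x = y"
    and mem: "\<And>x. x \<in> carrier A \<Longrightarrow> h x \<in> carrier B"
    and surj: "h ` carrier A = carrier B"
    using bij by (auto simp: bij_betw_def inj_on_eq_iff)
  have inverse: "h x \<otimes>\<^bsub>B\<^esub> h y = \<one>\<^bsub>B\<^esub> \<longleftrightarrow> x \<otimes>\<^bsub>A\<^esub> y = \<one>\<^bsub>A\<^esub>"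
    if "x \<in> carrier A" "y \<in> carrier A" for x y
    using that by (metis hom one closed inj)
  have "h ` Units A = Units B"
  proof
    show "h ` Units A \<subseteq> Units B"
      using mem inverse unfolding Units_def by blast
    show "Units B \<subseteq> h ` Units A"
    proof
      fix b assume "b \<in> Units B"
      then obtain b' where b: "b \<in> carrier B" "b' \<in> carrier B"
        "b' \<otimes>\<^bsub>B\<^esub> b = \<one>\<^bsub>B\<^esub>" "b \<otimes>\<^bsub>B\<^esub> b' = \<one>\<^bsub>B\<^esub>"
        by (auto simp: Units_def)
      then obtain a a' where a: "a \<in> carrier A" "a' \<in> carrier A" "b = h a" "b' = h a'"
        using surj by blast
      with b have "a' \<otimes>\<^bsub>A\<^esub> a = \<one>\<^bsub>A\<^esub>" "a \<otimes>\<^bsub>A\<^esub> a' = \<one>\<^bsub>A\<^esub>"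
        using inverse by auto
      with a show "b \<in> h ` Units A"
        by (auto simp: Units_def)
    qed
  qed
  moreover have "Units A \<subseteq> carrier A"
    by (auto simp: Units_def)
  ultimately have "bij_betw h (Units A) (Units B)"
    using bij by (metis bij_betw_def inj_on_subset)
  moreover from this have "h \<in> Units A \<rightarrow> Units B"
    using bij_betw_imp_funcset by blast
  ultimately show "h \<in> iso (units_of A) (units_of B)"
    using hom \<open>Units A \<subseteq> carrier A\<close>
    by (simp add: iso_def hom_def units_of_carrier units_of_mult subset_iff)
qed

lemma units_of_DirProd: "units_of (A \<times>\<times> B) = units_of A \<times>\<times> units_of B"
proof -
  have "Units (A \<times>\<times> B) = Units A \<times> Units B"
    by (auto simp: Units_def DirProd_def)
  then show ?thesis
    by (simp add: units_of_def DirProd_def)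
qed

lemma units_of_product_group:
  "units_of (product_group I G) = product_group I (\<lambda>i. units_of (G i))"
proof -
  have "Units (product_group I G) = (\<Pi>\<^sub>E i\<in>I. Units (G i))" (is "?L = ?R")
  proof
    show "?L \<subseteq> ?R"
    proof
      fix x assume "x \<in> ?L"
      then obtain y where x: "x \<in> (\<Pi>\<^sub>E i\<in>I. carrier (G i))" and y: "y \<in> (\<Pi>\<^sub>E i\<in>I. carrier (G i))"
        and yx: "(\<lambda>i\<in>I. y i \<otimes>\<^bsub>G i\<^esub> x i) = (\<lambda>i\<in>I. \<one>\<^bsub>G i\<^esub>)" and xy: "(\<lambda>i\<in>I. x i \<otimes>\<^bsub>G i\<^esub> y i) = (\<lambda>i\<in>I. \<one>\<^bsub>G i\<^esub>)"
        by (auto simp: Units_def)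
      have "y i \<otimes>\<^bsub>G i\<^esub> x i = \<one>\<^bsub>G i\<^esub>" "x i \<otimes>\<^bsub>G i\<^esub> y i = \<one>\<^bsub>G i\<^esub>" if "i \<in> I" for i
        using fun_cong[OF yx, of i] fun_cong[OF xy, of i] that by simp_all
      then have "x i \<in> Units (G i)" if "i \<in> I" for i
        using that x y unfolding Units_def by blast
      with x show "x \<in> ?R"
        by (simp add: PiE_iff)
    qed
    show "?R \<subseteq> ?L"
    proof
      fix x assume x: "x \<in> ?R"
      then have "\<forall>i\<in>I. \<exists>y. y \<in> carrier (G i) \<and> y \<otimes>\<^bsub>G i\<^esub> x i = \<one>\<^bsub>G i\<^esub> \<and> x i \<otimes>\<^bsub>G i\<^esub> y = \<one>\<^bsub>G i\<^esub>"
        by (fastforce simp: Units_def PiE_iff)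
      then obtain y where "\<forall>i\<in>I. y i \<in> carrier (G i) \<and> y i \<otimes>\<^bsub>G i\<^esub> x i = \<one>\<^bsub>G i\<^esub> \<and> x i \<otimes>\<^bsub>G i\<^esub> y i = \<one>\<^bsub>G i\<^esub>"
        by metis
      moreover have "x \<in> (\<Pi>\<^sub>E i\<in>I. carrier (G i))"
        using x by (auto simp: Units_def PiE_iff)
      ultimately show "x \<in> ?L"
        unfolding Units_def
        by (auto intro!: bexI[where x = "restrict y I"] restrict_ext)
    qed
  qed
  then show ?thesis
    by (simp add: units_of_def product_group_def)
qed

section \<open>Multiplication in the group algebra\<close>

context abelian_monoid
begin

lemma finsum_Times:
  assumes "finite A" "finite B" "f \<in> A \<times> B \<rightarrow> carrier G"
  shows "(\<Oplus>p\<in>A \<times> B. f p) = (\<Oplus>a\<in>A. \<Oplus>b\<in>B. f (a, b))"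
  using assms(1,3)
proof (induction A)
  case (insert a A)
  have f: "f (x, b) \<in> carrier G" if "x \<in> insert a A" "b \<in> B" for x b
    using insert.prems that by auto
  have "(\<Oplus>p\<in>insert a A \<times> B. f p) = (\<Oplus>p\<in>Pair a ` B \<union> A \<times> B. f p)"
    by (rule arg_cong[where f = "finsum G f"]) auto
  also have "\<dots> = (\<Oplus>p\<in>Pair a ` B. f p) \<oplus> (\<Oplus>p\<in>A \<times> B. f p)"
    using insert.hyps assms(2) f by (intro finsum_Un_disjoint) auto
  also have "(\<Oplus>p\<in>Pair a ` B. f p) = (\<Oplus>b\<in>B. f (a, b))"
    using f by (subst finsum_reindex) (auto simp: inj_on_def)
  also have "(\<Oplus>p\<in>A \<times> B. f p) = (\<Oplus>a\<in>A. \<Oplus>b\<in>B. f (a, b))"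
    using f by (intro insert.IH) auto
  also have "(\<Oplus>b\<in>B. f (a, b)) \<oplus> \<dots> = (\<Oplus>a\<in>insert a A. \<Oplus>b\<in>B. f (a, b))"
    using insert.hyps f by (subst finsum_insert) (auto intro!: finsum_closed)
  finally show ?case .
qed simp

lemma finsum_swap:
  assumes "finite A" "finite B" "\<And>a b. a \<in> A \<Longrightarrow> b \<in> B \<Longrightarrow> f a b \<in> carrier G"
  shows "(\<Oplus>a\<in>A. \<Oplus>b\<in>B. f a b) = (\<Oplus>b\<in>B. \<Oplus>a\<in>A. f a b)"
proof -
  have "(\<Oplus>a\<in>A. \<Oplus>b\<in>B. f a b) = (\<Oplus>p\<in>A \<times> B. f (fst p) (snd p))"
    using assms by (subst finsum_Times) auto
  also have "A \<times> B = prod.swap ` (B \<times> A)"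
    by auto
  also have "(\<Oplus>p\<in>prod.swap ` (B \<times> A). f (fst p) (snd p)) = (\<Oplus>q\<in>B \<times> A. f (snd q) (fst q))"
    using assms by (subst finsum_reindex) (auto simp: inj_on_def)
  also have "\<dots> = (\<Oplus>b\<in>B. \<Oplus>a\<in>A. f a b)"
    using assms by (subst finsum_Times) auto
  finally show ?thesis .
qed

end

lemma carrier_group_algebra: "carrier (group_algebra R G) = carrier G \<rightarrow>\<^sub>E carrier R"
  by (simp add: group_algebra_def)

lemma one_group_algebra:
  "\<one>\<^bsub>group_algebra R G\<^esub> = (\<lambda>x\<in>carrier G. if x = \<one>\<^bsub>G\<^esub> then \<one>\<^bsub>R\<^esub> else \<zero>\<^bsub>R\<^esub>)"
  by (simp add: group_algebra_def)

lemma mult_group_algebra: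
  "f \<otimes>\<^bsub>group_algebra R G\<^esub> g =
    (\<lambda>x\<in>carrier G. \<Oplus>\<^bsub>R\<^esub>y\<in>carrier G. f y \<otimes>\<^bsub>R\<^esub> g (inv\<^bsub>G\<^esub> y \<otimes>\<^bsub>G\<^esub> x))"
  by (simp add: group_algebra_def)

text \<open>The value at \<open>f\<close> of the linear extension of \<open>r\<close> to the group
  algebra. When \<open>r\<close> is a character or a matrix entry of a representation of G, this is
  the character or entry evaluated at the element with coefficients \<open>f\<close>.\<close>

definition pairing ::
    "('a, 'm) ring_scheme \<Rightarrow> ('g, 'n) monoid_scheme \<Rightarrow> ('g \<Rightarrow> 'a) \<Rightarrow> ('g \<Rightarrow> 'a) \<Rightarrow> 'a" where
  "pairing R G f r = (\<Oplus>\<^bsub>R\<^esub>x\<in>carrier G. f x \<otimes>\<^bsub>R\<^esub> r x)"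

locale finite_group_algebra = cring R + G: group G
  for R :: "('a, 'm) ring_scheme" (structure) and G :: "('g, 'n) monoid_scheme" +
  assumes fin: "finite (carrier G)"
begin

abbreviation A where "A \<equiv> group_algebra R G"

lemma group_algebra_mem: "f \<in> carrier A \<Longrightarrow> x \<in> carrier G \<Longrightarrow> f x \<in> carrier R"
  by (auto simp: carrier_group_algebra)

lemma group_algebra_closed:
  assumes "f \<in> carrier A" "g \<in> carrier A"
  shows "f \<otimes>\<^bsub>A\<^esub> g \<in> carrier A"
  using assms by (auto simp: carrier_group_algebra mult_group_algebra intro!: finsum_closed)

lemma one_group_algebra_closed: "\<one>\<^bsub>A\<^esub> \<in> carrier A"
  by (auto simp: carrier_group_algebra one_group_algebra)

lemma pairing_closed [simp]:
  assumes "f \<in> carrier G \<rightarrow> carrier R" "r \<in> carrier G \<rightarrow> carrier R"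
  shows "pairing R G f r \<in> carrier R"
  using assms unfolding pairing_def by (intro finsum_closed) auto

lemma pairing_one:
  assumes "r \<in> carrier G \<rightarrow> carrier R"
  shows "pairing R G \<one>\<^bsub>A\<^esub> r = r \<one>\<^bsub>G\<^esub>"
proof -
  have "pairing R G \<one>\<^bsub>A\<^esub> r = (\<Oplus>x\<in>carrier G. if \<one>\<^bsub>G\<^esub> = x then r x else \<zero>)"
    unfolding pairing_def using assms
    by (intro finsum_cong') (auto simp: one_group_algebra Pi_iff)
  also have "\<dots> = r \<one>\<^bsub>G\<^esub>"
    using assms by (intro finsum_singleton fin) auto
  finally show ?thesis .
qed

text \<open>Substituting z = y w turns the convolution into a sum over independent y and w, where
  \<open>r\<close> meets only the product y w. Any rule for \<open>r\<close> on products can then be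
  applied termwise.\<close>

lemma pairing_mult:
  assumes f: "f \<in> carrier A" and g: "g \<in> carrier A"
    and r: "r \<in> carrier G \<rightarrow> carrier R"
  shows "pairing R G (f \<otimes>\<^bsub>A\<^esub> g) r =
    (\<Oplus>y\<in>carrier G. \<Oplus>w\<in>carrier G. f y \<otimes> g w \<otimes> r (y \<otimes>\<^bsub>G\<^esub> w))"
proof -
  note [simp] = group_algebra_mem[OF f] group_algebra_mem[OF g] funcset_mem[OF r]
  have "pairing R G (f \<otimes>\<^bsub>A\<^esub> g) r =
      (\<Oplus>z\<in>carrier G. \<Oplus>y\<in>carrier G. f y \<otimes> g (inv\<^bsub>G\<^esub> y \<otimes>\<^bsub>G\<^esub> z) \<otimes> r z)"
    unfolding pairing_def
    by (intro finsum_cong') (auto simp: mult_group_algebra fin intro!: finsum_closed finsum_ldistr)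
  also have "\<dots> = (\<Oplus>y\<in>carrier G. \<Oplus>z\<in>carrier G. f y \<otimes> g (inv\<^bsub>G\<^esub> y \<otimes>\<^bsub>G\<^esub> z) \<otimes> r z)"
    using fin by (intro finsum_swap) auto
  also have "\<dots> = (\<Oplus>y\<in>carrier G. \<Oplus>w\<in>carrier G. f y \<otimes> g w \<otimes> r (y \<otimes>\<^bsub>G\<^esub> w))"
  proof (rule finsum_cong'[OF refl])
    fix y assume y: "y \<in> carrier G"
    have "(\<Oplus>z\<in>carrier G. f y \<otimes> g (inv\<^bsub>G\<^esub> y \<otimes>\<^bsub>G\<^esub> z) \<otimes> r z)
        = (\<Oplus>z\<in>(\<lambda>w. y \<otimes>\<^bsub>G\<^esub> w) ` carrier G. f y \<otimes> g (inv\<^bsub>G\<^esub> y \<otimes>\<^bsub>G\<^esub> z) \<otimes> r z)"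
      using y by (simp add: G.surj_const_mult)
    also have "\<dots> = (\<Oplus>w\<in>carrier G. f y \<otimes> g (inv\<^bsub>G\<^esub> y \<otimes>\<^bsub>G\<^esub> (y \<otimes>\<^bsub>G\<^esub> w)) \<otimes> r (y \<otimes>\<^bsub>G\<^esub> w))"
      using y by (intro finsum_reindex G.inj_on_cmult) auto
    also have "\<dots> = (\<Oplus>w\<in>carrier G. f y \<otimes> g w \<otimes> r (y \<otimes>\<^bsub>G\<^esub> w))"
      using y by (intro finsum_cong') (auto simp flip: G.m_assoc)
    finally show "(\<Oplus>z\<in>carrier G. f y \<otimes> g (inv\<^bsub>G\<^esub> y \<otimes>\<^bsub>G\<^esub> z) \<otimes> r z) = \<dots>" .
  qed (auto intro!: finsum_closed)
  finally show ?thesis .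
qed

text \<open>
  With one summand this is the multiplicativity of a linear character; with \<open>I\<close> the set of row
  indices it is the matrix product of the coefficients of a matrix representation.
\<close>

lemma pairing_mult_sum:
  assumes f: "f \<in> carrier A" and g: "g \<in> carrier A" and "finite I"
    and s: "\<And>k. k \<in> I \<Longrightarrow> s k \<in> carrier G \<rightarrow> carrier R"
    and t: "\<And>k. k \<in> I \<Longrightarrow> t k \<in> carrier G \<rightarrow> carrier R"
    and r: "\<And>y w. y \<in> carrier G \<Longrightarrow> w \<in> carrier G \<Longrightarrow>
      r (y \<otimes>\<^bsub>G\<^esub> w) = (\<Oplus>k\<in>I. s k y \<otimes> t k w)"
  shows "pairing R G (f \<otimes>\<^bsub>A\<^esub> g) r = (\<Oplus>k\<in>I. pairing R G f (s k) \<otimes> pairing R G g (t k))"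
proof -
  note [simp] = group_algebra_mem[OF f] group_algebra_mem[OF g] funcset_mem[OF s] funcset_mem[OF t]
  have rG: "r \<in> carrier G \<rightarrow> carrier R"
  proof
    fix x assume x: "x \<in> carrier G"
    \<comment> \<open>Closure of \<open>r\<close> is read off from its product rule with the left
      factor equal to one.\<close>
    have "r x = (\<Oplus>k\<in>I. s k \<one>\<^bsub>G\<^esub> \<otimes> t k x)"
      using r[of "\<one>\<^bsub>G\<^esub>" x] x by simp
    then show "r x \<in> carrier R"
      using x by (auto intro!: finsum_closed)
  qed
  have "pairing R G (f \<otimes>\<^bsub>A\<^esub> g) r =
      (\<Oplus>y\<in>carrier G. \<Oplus>w\<in>carrier G. \<Oplus>k\<in>I. (f y \<otimes> s k y) \<otimes> (g w \<otimes> t k w))"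
    unfolding pairing_mult[OF f g rG]
  proof (intro finsum_cong' refl)
    fix y w assume y: "y \<in> carrier G" and w: "w \<in> carrier G"
    then have "f y \<otimes> g w \<otimes> r (y \<otimes>\<^bsub>G\<^esub> w) = (\<Oplus>k\<in>I. f y \<otimes> g w \<otimes> (s k y \<otimes> t k w))"
      using \<open>finite I\<close> by (simp add: r finsum_rdistr)
    also have "\<dots> = (\<Oplus>k\<in>I. (f y \<otimes> s k y) \<otimes> (g w \<otimes> t k w))"
      using y w by (intro finsum_cong') (auto simp: m_ac)
    finally show "f y \<otimes> g w \<otimes> r (y \<otimes>\<^bsub>G\<^esub> w) = \<dots>" .
  qed (auto intro!: finsum_closed)
  also have "\<dots> = (\<Oplus>y\<in>carrier G. \<Oplus>k\<in>I. \<Oplus>w\<in>carrier G. (f y \<otimes> s k y) \<otimes> (g w \<otimes> t k w))"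
  proof (rule finsum_cong'[OF refl])
    show "(\<Oplus>w\<in>carrier G. \<Oplus>k\<in>I. (f y \<otimes> s k y) \<otimes> (g w \<otimes> t k w))
        = (\<Oplus>k\<in>I. \<Oplus>w\<in>carrier G. (f y \<otimes> s k y) \<otimes> (g w \<otimes> t k w))" if "y \<in> carrier G" for y
      using fin \<open>finite I\<close> that by (intro finsum_swap) auto
  qed (auto intro!: finsum_closed)
  also have "\<dots> = (\<Oplus>k\<in>I. \<Oplus>y\<in>carrier G. \<Oplus>w\<in>carrier G. (f y \<otimes> s k y) \<otimes> (g w \<otimes> t k w))"
    using fin \<open>finite I\<close> by (intro finsum_swap) (auto intro!: finsum_closed)
  also have "\<dots> = (\<Oplus>k\<in>I. pairing R G f (s k) \<otimes> pairing R G g (t k))"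
  proof (intro finsum_cong' refl)
    fix k assume k: "k \<in> I"
    have "(\<Oplus>y\<in>carrier G. \<Oplus>w\<in>carrier G. (f y \<otimes> s k y) \<otimes> (g w \<otimes> t k w))
        = (\<Oplus>y\<in>carrier G. (f y \<otimes> s k y) \<otimes> pairing R G g (t k))"
      unfolding pairing_def using k fin
      by (intro finsum_cong' refl finsum_rdistr[symmetric]) (auto intro!: finsum_closed)
    also have "\<dots> = pairing R G f (s k) \<otimes> pairing R G g (t k)"
      unfolding pairing_def[of R G f] using k fin
      by (intro finsum_ldistr[symmetric]) (auto intro!: pairing_closed)
    finally show "(\<Oplus>y\<in>carrier G. \<Oplus>w\<in>carrier G. (f y \<otimes> s k y) \<otimes> (g w \<otimes> t k w)) = \<dots>" .
  qed (auto intro!: pairing_closed)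
  finally show ?thesis .
qed

lemma pairing_mult_character:
  assumes f: "f \<in> carrier A" and g: "g \<in> carrier A" and r: "r \<in> carrier G \<rightarrow> carrier R"
    and mult: "\<And>y w. y \<in> carrier G \<Longrightarrow> w \<in> carrier G \<Longrightarrow> r (y \<otimes>\<^bsub>G\<^esub> w) = r y \<otimes> r w"
  shows "pairing R G (f \<otimes>\<^bsub>A\<^esub> g) r = pairing R G f r \<otimes> pairing R G g r"
proof -
  have mem: "pairing R G h r \<in> carrier R" if "h \<in> carrier A" for h
    using that r by (auto intro!: pairing_closed simp: carrier_group_algebra)
  show ?thesis
    using pairing_mult_sum[OF f g, of "{()}" "\<lambda>_. r" "\<lambda>_. r" r] r mem[OF f] mem[OF g]
    by (simp add: mult funcset_mem[OF r])
qed

text \<open>Reduces equality of images to a kernel statement. The pointwise difference is not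
  extensional, which is why the arguments range over plain function spaces and not over the carrier
  of the algebra.\<close>

lemma pairing_diff:
  assumes "f \<in> carrier G \<rightarrow> carrier R" "g \<in> carrier G \<rightarrow> carrier R" "r \<in> carrier G \<rightarrow> carrier R"
  shows "pairing R G (\<lambda>x. f x \<ominus> g x) r = pairing R G f r \<ominus> pairing R G g r"
proof -
  note [simp] = assms[THEN funcset_mem]
  have "pairing R G (\<lambda>x. f x \<ominus> g x) r \<oplus> pairing R G g r =
      (\<Oplus>x\<in>carrier G. (f x \<ominus> g x) \<otimes> r x \<oplus> g x \<otimes> r x)"
    unfolding pairing_def by (subst finsum_addf) auto
  also have "\<dots> = pairing R G f r"
  proof -
    have "(f x \<ominus> g x) \<otimes> r x \<oplus> g x \<otimes> r x = f x \<otimes> r x" if "x \<in> carrier G" for x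
    proof -
      have "f x \<in> carrier R" "g x \<in> carrier R" "r x \<in> carrier R"
        using that by simp_all
      then show ?thesis by (simp add: minus_eq l_distr l_minus a_assoc l_neg)
    qed
    then show ?thesis
      unfolding pairing_def by (intro finsum_cong') auto
  qed
  finally have "pairing R G f r \<ominus> pairing R G g r =
      (pairing R G (\<lambda>x. f x \<ominus> g x) r \<oplus> pairing R G g r) \<ominus> pairing R G g r"
    by simp
  also have "\<dots> = pairing R G (\<lambda>x. f x \<ominus> g x) r"
    using assms by (simp add: minus_eq a_assoc r_neg)
  finally show ?thesis ..
qed

end

section \<open>Representations of the quaternion group\<close>

lemma Q8_carrier: "carrier Q8 = {(1, 0, 0, 0), (-1, 0, 0, 0), (0, 1, 0, 0), (0, -1, 0, 0),
                (0, 0, 1, 0), (0, 0, -1, 0), (0, 0, 0, 1), (0, 0, 0, -1)}"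
  by (simp add: Q8_def)

lemma Q8_mult: "x \<otimes>\<^bsub>Q8\<^esub> y = quat_mult x y"
  by (simp add: Q8_def)

lemma Q8_one: "\<one>\<^bsub>Q8\<^esub> = (1, 0, 0, 0)"
  by (simp add: Q8_def)

text \<open>
  The two binary digits of \<open>m < 4\<close> select the signs at \<open>i\<close> and \<open>j\<close>. On \<open>Q8\<close> exactly one coordinate is
  nonzero, so that the quadratic form below reads off the sign.
\<close>

fun quat_char :: "nat \<Rightarrow> int_quat \<Rightarrow> int" where
  "quat_char m (a, b, c, d) =
    (let s = if m < 2 then 1 else -1; t = if even m then 1 else -1
     in a * a + s * b * b + t * c * c + s * t * d * d)"

lemma quat_char_mult:
  assumes "x \<in> carrier Q8" "y \<in> carrier Q8"
  shows "quat_char m (x \<otimes>\<^bsub>Q8\<^esub> y) = quat_char m x * quat_char m y"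
  using assms unfolding Q8_carrier Q8_mult by (elim insertE emptyE; simp)

lemma quat_char_one: "quat_char m \<one>\<^bsub>Q8\<^esub> = 1"
  by (simp add: Q8_one)

text \<open>
  The \<open>(i, j)\<close> entry of the image of a quaternion under the matrix representation that sends \<open>i\<close> to
  the matrix with rows \<open>(u, v)\<close>, \<open>(v, -u)\<close> and \<open>j\<close> to the one with rows \<open>(0, -1)\<close>, \<open>(1, 0)\<close>; it is
  multiplicative if \<open>u\<^sup>2 + v\<^sup>2 = -1\<close>.
\<close>

fun quat_entry :: "('a, 'm) ring_scheme \<Rightarrow> 'a \<Rightarrow> 'a \<Rightarrow> nat \<Rightarrow> nat \<Rightarrow> int_quat \<Rightarrow> 'a" where
  "quat_entry R u v i j (a, b, c, d) =
    (let a' = \<guillemotleft>a\<guillemotright>\<^bsub>R\<^esub>; b' = \<guillemotleft>b\<guillemotright>\<^bsub>R\<^esub>; c' = \<guillemotleft>c\<guillemotright>\<^bsub>R\<^esub>; d' = \<guillemotleft>d\<guillemotright>\<^bsub>R\<^esub> in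
     if i = 0 then
       if j = 0 then a' \<oplus>\<^bsub>R\<^esub> b' \<otimes>\<^bsub>R\<^esub> u \<oplus>\<^bsub>R\<^esub> d' \<otimes>\<^bsub>R\<^esub> v
       else b' \<otimes>\<^bsub>R\<^esub> v \<ominus>\<^bsub>R\<^esub> c' \<ominus>\<^bsub>R\<^esub> d' \<otimes>\<^bsub>R\<^esub> u
     else
       if j = 0 then b' \<otimes>\<^bsub>R\<^esub> v \<oplus>\<^bsub>R\<^esub> c' \<ominus>\<^bsub>R\<^esub> d' \<otimes>\<^bsub>R\<^esub> u
       else a' \<ominus>\<^bsub>R\<^esub> b' \<otimes>\<^bsub>R\<^esub> u \<ominus>\<^bsub>R\<^esub> d' \<otimes>\<^bsub>R\<^esub> v)"

context cring
begin

lemma quat_entry_closed [simp]: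
  assumes "u \<in> carrier R" "v \<in> carrier R"
  shows "quat_entry R u v i j x \<in> carrier R"
  using assms by (cases x) (simp add: Let_def)

lemma quat_entry_one:
  assumes "u \<in> carrier R" "v \<in> carrier R" "i < 2" "j < 2"
  shows "quat_entry R u v i j \<one>\<^bsub>Q8\<^esub> = (if i = j then \<one> else \<zero>)"
  using assms by (auto simp: Q8_one less_2_cases_iff minus_eq)

text \<open>The shapes in which u^2 + v^2 = -1 turns up in the 8 * 8 * 4 cases of
  \<open>quat_entry_mult\<close>, oriented for rewriting.\<close>

lemma quat_entry_mult_aux:
  assumes "u \<in> carrier R" "v \<in> carrier R" and uv: "u \<otimes> u \<oplus> v \<otimes> v = \<ominus> \<one>"
  shows "v \<otimes> v \<oplus> u \<otimes> u = \<ominus> \<one>"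
    and "\<ominus> (u \<otimes> u) \<oplus> \<ominus> (v \<otimes> v) = \<one>" and "\<ominus> (v \<otimes> v) \<oplus> \<ominus> (u \<otimes> u) = \<one>"
proof -
  show "v \<otimes> v \<oplus> u \<otimes> u = \<ominus> \<one>"
    using assms by (simp add: a_comm)
  have "\<ominus> (u \<otimes> u) \<oplus> \<ominus> (v \<otimes> v) = \<ominus> (u \<otimes> u \<oplus> v \<otimes> v)"
    using assms(1,2) by (simp add: minus_add)
  then show "\<ominus> (u \<otimes> u) \<oplus> \<ominus> (v \<otimes> v) = \<one>"
    using uv by simp
  then show "\<ominus> (v \<otimes> v) \<oplus> \<ominus> (u \<otimes> u) = \<one>"
    using assms(1,2) by (simp add: a_comm)
qed

text \<open>The matrix I with rows (u, v), (v, -u) has square (u^2 + v^2) = -1, J with rows (0, -1),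
  (1, 0) has square -1, and I J = -J I has rows (v, -u), (-u, -v), the coefficients of
  \<open>d'\<close>. These are the defining relations of \<open>Q8\<close>; the proof checks all
  products of group elements entrywise.\<close>

lemma quat_entry_mult:
  assumes u: "u \<in> carrier R" and v: "v \<in> carrier R" and uv: "u \<otimes> u \<oplus> v \<otimes> v = \<ominus> \<one>"
    and x: "x \<in> carrier Q8" and y: "y \<in> carrier Q8" and i: "i < 2" and j: "j < 2"
  shows "quat_entry R u v i j (x \<otimes>\<^bsub>Q8\<^esub> y) =
    quat_entry R u v i 0 x \<otimes> quat_entry R u v 0 j y \<oplus> quat_entry R u v i 1 x \<otimes> quat_entry R u v 1 j y"
proof -
  have "u \<otimes> v = v \<otimes> u"
    using u v by (rule m_comm)
  note simps = u v uv quat_entry_mult_aux[OF u v uv] this Let_def minus_eq l_minus r_minus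
    l_neg r_neg
  have ij: "i = 0 \<and> j = 0 \<or> i = 0 \<and> j = 1 \<or> i = 1 \<and> j = 0 \<or> i = 1 \<and> j = 1"
    using i j by auto
  show ?thesis
    using x ij y unfolding Q8_carrier Q8_mult
    by (elim insertE emptyE; elim disjE conjE; simp add: simps)
qed

end

section \<open>Functions on the quaternion group killed by all representations\<close>

context domain
begin

text \<open>x = y and x = -y give 2 y = 0. Every use of 2 being nonzero passes through this
  lemma.\<close>

lemma sum_diff_eq_zeroD:
  assumes two: "\<one> \<oplus> \<one> \<noteq> \<zero>" and x: "x \<in> carrier R" and y: "y \<in> carrier R"
    and "x \<oplus> y = \<zero>" "x \<ominus> y = \<zero>"
  shows "x = \<zero>" "y = \<zero>"
proof -
  have "x = y"
    using assms by simp
  then have "(\<one> \<oplus> \<one>) \<otimes> y = \<zero>"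
    using assms by (simp add: l_distr)
  then show "y = \<zero>"
    using two y integral by blast
  with \<open>x = y\<close> show "x = \<zero>"
    by simp
qed

text \<open>The bracketing puts each element next to its negative, so that for even or odd
  \<open>r\<close> a common factor can be taken out of each pair.\<close>

lemma pairing_Q8:
  assumes "f \<in> carrier Q8 \<rightarrow> carrier R" "r \<in> carrier Q8 \<rightarrow> carrier R"
  shows "pairing R Q8 f r =
    (f (1, 0, 0, 0) \<otimes> r (1, 0, 0, 0) \<oplus> f (-1, 0, 0, 0) \<otimes> r (-1, 0, 0, 0)) \<oplus>
    ((f (0, 1, 0, 0) \<otimes> r (0, 1, 0, 0) \<oplus> f (0, -1, 0, 0) \<otimes> r (0, -1, 0, 0)) \<oplus>
    ((f (0, 0, 1, 0) \<otimes> r (0, 0, 1, 0) \<oplus> f (0, 0, -1, 0) \<otimes> r (0, 0, -1, 0)) \<oplus>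
    (f (0, 0, 0, 1) \<otimes> r (0, 0, 0, 1) \<oplus> f (0, 0, 0, -1) \<otimes> r (0, 0, 0, -1))))"
proof -
  have [simp]: "f x \<in> carrier R" "r x \<in> carrier R" if "x \<in> carrier Q8" for x
    using assms that by auto
  show ?thesis
    unfolding pairing_def Q8_carrier by (simp add: a_assoc Q8_carrier)
qed

lemma add_mult_eq_diff_mult:
  assumes "p \<in> carrier R" "n \<in> carrier R" "r \<in> carrier R"
  shows "p \<otimes> r \<oplus> n \<otimes> \<ominus> r = (p \<ominus> n) \<otimes> r"
  using assms by (simp add: minus_eq l_distr l_minus r_minus)

text \<open>The signs form the character table of Q_8 / {1, -1}, isomorphic to C_2 x C_2, a Hadamard
  matrix of order four. It is inverted in two rounds of sums and differences: first
  \<open>a \<oplus> b\<close> against \<open>c \<oplus> d\<close> and \<open>a \<ominus> b\<close>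
  against \<open>c \<ominus> d\<close>, then a against b and c against d.\<close>

lemma quat_char_kernel:
  assumes two: "\<one> \<oplus> \<one> \<noteq> \<zero>"
    and [simp]: "a \<in> carrier R" "b \<in> carrier R" "c \<in> carrier R" "d \<in> carrier R"
    and eq: "a \<oplus> (b \<oplus> (c \<oplus> d)) = \<zero>" "a \<oplus> (b \<oplus> (\<ominus> c \<oplus> \<ominus> d)) = \<zero>"
      "a \<oplus> (\<ominus> b \<oplus> (c \<oplus> \<ominus> d)) = \<zero>" "a \<oplus> (\<ominus> b \<oplus> (\<ominus> c \<oplus> d)) = \<zero>"
  shows "a = \<zero>" "b = \<zero>" "c = \<zero>" "d = \<zero>"
proof -
  have "(a \<oplus> b) \<oplus> (c \<oplus> d) = \<zero>" "(a \<oplus> b) \<ominus> (c \<oplus> d) = \<zero>"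
    "(a \<ominus> b) \<oplus> (c \<ominus> d) = \<zero>" "(a \<ominus> b) \<ominus> (c \<ominus> d) = \<zero>"
    using eq by (simp_all add: a_assoc minus_eq minus_add)
  then have "a \<oplus> b = \<zero>" "c \<oplus> d = \<zero>" "a \<ominus> b = \<zero>" "c \<ominus> d = \<zero>"
    using sum_diff_eq_zeroD[OF two, of "a \<oplus> b" "c \<oplus> d"]
      sum_diff_eq_zeroD[OF two, of "a \<ominus> b" "c \<ominus> d"] by auto
  then show "a = \<zero>" "b = \<zero>" "c = \<zero>" "d = \<zero>"
    using sum_diff_eq_zeroD[OF two, of a b] sum_diff_eq_zeroD[OF two, of c d] by auto
qed

text \<open>The two diagonal entries separate a from b u + d v, the two off-diagonal ones c from b v
  - d u. What remains is a linear system for b and d with rows (u, v), (v, -u), whose determinant is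
  -(u^2 + v^2) = 1.\<close>

lemma quat_matrix_kernel:
  assumes two: "\<one> \<oplus> \<one> \<noteq> \<zero>"
    and [simp]: "u \<in> carrier R" "v \<in> carrier R" and uv: "u \<otimes> u \<oplus> v \<otimes> v = \<ominus> \<one>"
    and [simp]: "a \<in> carrier R" "b \<in> carrier R" "c \<in> carrier R" "d \<in> carrier R"
    and eq: "a \<oplus> (b \<otimes> u \<oplus> d \<otimes> v) = \<zero>" "a \<oplus> (\<ominus> (b \<otimes> u) \<oplus> \<ominus> (d \<otimes> v)) = \<zero>"
      "b \<otimes> v \<oplus> (c \<oplus> \<ominus> (d \<otimes> u)) = \<zero>" "b \<otimes> v \<oplus> (\<ominus> c \<oplus> \<ominus> (d \<otimes> u)) = \<zero>"
  shows "a = \<zero>" "b = \<zero>" "c = \<zero>" "d = \<zero>"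
proof -
  have "a \<oplus> (b \<otimes> u \<oplus> d \<otimes> v) = \<zero>" "a \<ominus> (b \<otimes> u \<oplus> d \<otimes> v) = \<zero>"
    "(b \<otimes> v \<ominus> d \<otimes> u) \<oplus> c = \<zero>" "(b \<otimes> v \<ominus> d \<otimes> u) \<ominus> c = \<zero>"
    using eq by (simp_all add: a_ac minus_eq minus_add)
  then have a: "a = \<zero>" and c: "c = \<zero>"
    and bd: "b \<otimes> u \<oplus> d \<otimes> v = \<zero>" "b \<otimes> v \<ominus> d \<otimes> u = \<zero>"
    using sum_diff_eq_zeroD[OF two, of a "b \<otimes> u \<oplus> d \<otimes> v"]
      sum_diff_eq_zeroD[OF two, of "b \<otimes> v \<ominus> d \<otimes> u" c] by auto
  \<comment> \<open>The matrix of the system squares to -1, so applying it once more isolates -b;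
    the terms in d cancel by commutativity.\<close>
  have "\<ominus> b = b \<otimes> (u \<otimes> u \<oplus> v \<otimes> v)"
    by (simp add: uv r_minus)
  also have "\<dots> = (b \<otimes> u \<oplus> d \<otimes> v) \<otimes> u \<oplus> (b \<otimes> v \<ominus> d \<otimes> u) \<otimes> v"
  proof -
    have "(b \<otimes> u \<oplus> d \<otimes> v) \<otimes> u \<oplus> (b \<otimes> v \<ominus> d \<otimes> u) \<otimes> v =
        (b \<otimes> (u \<otimes> u) \<oplus> b \<otimes> (v \<otimes> v)) \<oplus> (d \<otimes> (v \<otimes> u) \<oplus> \<ominus> (d \<otimes> (u \<otimes> v)))"
      by (simp add: minus_eq l_distr l_minus m_assoc a_ac)
    also have "\<dots> = b \<otimes> (u \<otimes> u \<oplus> v \<otimes> v)"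
      by (simp add: r_distr r_neg m_comm[of v u])
    finally show ?thesis ..
  qed
  also have "\<dots> = \<zero>"
    by (simp add: bd)
  finally have b: "b = \<zero>"
    by simp
  have "d \<otimes> v = \<zero>" "d \<otimes> u = \<zero>"
    using bd by (simp_all add: b)
  then have "d \<otimes> (u \<otimes> u \<oplus> v \<otimes> v) = \<zero>"
    by (simp add: r_distr flip: m_assoc)
  then have "d = \<zero>"
    by (simp add: uv r_minus)
  with a b c show "a = \<zero>" "b = \<zero>" "c = \<zero>" "d = \<zero>"
    by auto
qed

lemma pairing_Q8_even:
  assumes f: "f \<in> carrier Q8 \<rightarrow> carrier R" and r: "r \<in> carrier Q8 \<rightarrow> carrier R"
    and even: "r (-1, 0, 0, 0) = r (1, 0, 0, 0)" "r (0, -1, 0, 0) = r (0, 1, 0, 0)"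
      "r (0, 0, -1, 0) = r (0, 0, 1, 0)" "r (0, 0, 0, -1) = r (0, 0, 0, 1)"
  shows "pairing R Q8 f r =
    (f (1, 0, 0, 0) \<oplus> f (-1, 0, 0, 0)) \<otimes> r (1, 0, 0, 0) \<oplus>
    ((f (0, 1, 0, 0) \<oplus> f (0, -1, 0, 0)) \<otimes> r (0, 1, 0, 0) \<oplus>
    ((f (0, 0, 1, 0) \<oplus> f (0, 0, -1, 0)) \<otimes> r (0, 0, 1, 0) \<oplus>
    (f (0, 0, 0, 1) \<oplus> f (0, 0, 0, -1)) \<otimes> r (0, 0, 0, 1)))"
  unfolding pairing_Q8[OF f r] even using f r by (simp add: Q8_carrier l_distr)

lemma pairing_Q8_odd:
  assumes f: "f \<in> carrier Q8 \<rightarrow> carrier R" and r: "r \<in> carrier Q8 \<rightarrow> carrier R"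
    and odd: "r (-1, 0, 0, 0) = \<ominus> r (1, 0, 0, 0)" "r (0, -1, 0, 0) = \<ominus> r (0, 1, 0, 0)"
      "r (0, 0, -1, 0) = \<ominus> r (0, 0, 1, 0)" "r (0, 0, 0, -1) = \<ominus> r (0, 0, 0, 1)"
  shows "pairing R Q8 f r =
    (f (1, 0, 0, 0) \<ominus> f (-1, 0, 0, 0)) \<otimes> r (1, 0, 0, 0) \<oplus>
    ((f (0, 1, 0, 0) \<ominus> f (0, -1, 0, 0)) \<otimes> r (0, 1, 0, 0) \<oplus>
    ((f (0, 0, 1, 0) \<ominus> f (0, 0, -1, 0)) \<otimes> r (0, 0, 1, 0) \<oplus>
    (f (0, 0, 0, 1) \<ominus> f (0, 0, 0, -1)) \<otimes> r (0, 0, 0, 1)))"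
  unfolding pairing_Q8[OF f r] odd using f r by (simp add: Q8_carrier add_mult_eq_diff_mult)

text \<open>The four linear characters take the value 1 at -1, so they see only the sums f(x) +
  f(-x); the matrix representation sends -1 to minus the identity, so its entries see only the
  differences f(x) - f(-x). The eight equations thus split into two systems with four unknowns each,
  and f is recovered from sums and differences.\<close>

lemma quat_kernel:
  assumes two: "\<one> \<oplus> \<one> \<noteq> \<zero>"
    and u: "u \<in> carrier R" and v: "v \<in> carrier R" and uv: "u \<otimes> u \<oplus> v \<otimes> v = \<ominus> \<one>"
    and f: "f \<in> carrier Q8 \<rightarrow> carrier R"
    and chars: "\<And>m. m < 4 \<Longrightarrow> pairing R Q8 f (\<lambda>x. \<guillemotleft>quat_char m x\<guillemotright>) = \<zero>"
    and entries: "\<And>i j. i < 2 \<Longrightarrow> j < 2 \<Longrightarrow> pairing R Q8 f (quat_entry R u v i j) = \<zero>"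
    and x: "x \<in> carrier Q8"
  shows "f x = \<zero>"
proof -
  have f_mem: "f (1, 0, 0, 0) \<in> carrier R" "f (-1, 0, 0, 0) \<in> carrier R"
    "f (0, 1, 0, 0) \<in> carrier R" "f (0, -1, 0, 0) \<in> carrier R"
    "f (0, 0, 1, 0) \<in> carrier R" "f (0, 0, -1, 0) \<in> carrier R"
    "f (0, 0, 0, 1) \<in> carrier R" "f (0, 0, 0, -1) \<in> carrier R"
    using f by (simp_all add: Q8_carrier)
  have odd: "quat_entry R u v i j (-1, 0, 0, 0) = \<ominus> quat_entry R u v i j (1, 0, 0, 0)"
    "quat_entry R u v i j (0, -1, 0, 0) = \<ominus> quat_entry R u v i j (0, 1, 0, 0)"
    "quat_entry R u v i j (0, 0, -1, 0) = \<ominus> quat_entry R u v i j (0, 0, 1, 0)"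
    "quat_entry R u v i j (0, 0, 0, -1) = \<ominus> quat_entry R u v i j (0, 0, 0, 1)" for i j
    using u v by (simp_all add: Let_def minus_eq l_minus)
  have entry: "quat_entry R u v i j \<in> carrier Q8 \<rightarrow> carrier R" for i j
    using u v by simp
  define s where "s x y = f x \<oplus> f y" for x y
  define d where "d x y = f x \<ominus> f y" for x y
  define s1 s2 s3 s4 where "s1 = s (1, 0, 0, 0) (-1, 0, 0, 0)" and "s2 = s (0, 1, 0, 0) (0, -1, 0, 0)"
    and "s3 = s (0, 0, 1, 0) (0, 0, -1, 0)" and "s4 = s (0, 0, 0, 1) (0, 0, 0, -1)"
  define d1 d2 d3 d4 where "d1 = d (1, 0, 0, 0) (-1, 0, 0, 0)" and "d2 = d (0, 1, 0, 0) (0, -1, 0, 0)"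
    and "d3 = d (0, 0, 1, 0) (0, 0, -1, 0)" and "d4 = d (0, 0, 0, 1) (0, 0, 0, -1)"
  note s_defs = s1_def s2_def s3_def s4_def s_def and d_defs = d1_def d2_def d3_def d4_def d_def
  have s_mem: "s1 \<in> carrier R" "s2 \<in> carrier R" "s3 \<in> carrier R" "s4 \<in> carrier R"
    and d_mem: "d1 \<in> carrier R" "d2 \<in> carrier R" "d3 \<in> carrier R" "d4 \<in> carrier R"
    using f_mem by (simp_all add: s_defs d_defs)
  have "pairing R Q8 f (\<lambda>x. \<guillemotleft>quat_char m x\<guillemotright>) =
      s1 \<otimes> \<guillemotleft>quat_char m (1, 0, 0, 0)\<guillemotright> \<oplus> (s2 \<otimes> \<guillemotleft>quat_char m (0, 1, 0, 0)\<guillemotright> \<oplus>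
      (s3 \<otimes> \<guillemotleft>quat_char m (0, 0, 1, 0)\<guillemotright> \<oplus> s4 \<otimes> \<guillemotleft>quat_char m (0, 0, 0, 1)\<guillemotright>))" for m
    unfolding s_defs by (rule pairing_Q8_even[OF f]) (simp_all del: of_int_add of_int_mult)
  then have "s1 = \<zero>" "s2 = \<zero>" "s3 = \<zero>" "s4 = \<zero>"
    using chars[of 0] chars[of 1] chars[of 2] chars[of 3] s_mem
    by (intro quat_char_kernel[OF two s_mem]; simp add: r_minus)+
  moreover have "pairing R Q8 f (quat_entry R u v i j) =
      d1 \<otimes> quat_entry R u v i j (1, 0, 0, 0) \<oplus> (d2 \<otimes> quat_entry R u v i j (0, 1, 0, 0) \<oplus>
      (d3 \<otimes> quat_entry R u v i j (0, 0, 1, 0) \<oplus> d4 \<otimes> quat_entry R u v i j (0, 0, 0, 1)))" for i j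
    unfolding d_defs by (rule pairing_Q8_odd[OF f entry odd])
  then have "d1 = \<zero>" "d2 = \<zero>" "d3 = \<zero>" "d4 = \<zero>"
    using entries[of 0 0] entries[of 0 1] entries[of 1 0] entries[of 1 1] u v d_mem
    by (intro quat_matrix_kernel[OF two u v uv d_mem]; simp add: Let_def minus_eq r_minus)+
  ultimately have sd: "s1 = \<zero>" "d1 = \<zero>" "s2 = \<zero>" "d2 = \<zero>" "s3 = \<zero>" "d3 = \<zero>" "s4 = \<zero>" "d4 = \<zero>"
    by simp_all
  note zero = sum_diff_eq_zeroD[OF two f_mem(1,2) sd(1,2)[unfolded s_defs d_defs]]
    sum_diff_eq_zeroD[OF two f_mem(3,4) sd(3,4)[unfolded s_defs d_defs]]
    sum_diff_eq_zeroD[OF two f_mem(5,6) sd(5,6)[unfolded s_defs d_defs]]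
    sum_diff_eq_zeroD[OF two f_mem(7,8) sd(7,8)[unfolded s_defs d_defs]]
  show ?thesis
    using x unfolding Q8_carrier by (elim insertE emptyE) (simp_all only: zero)
qed

end

section \<open>Finite fields\<close>

locale finite_field = field R for R :: "('a, 'm) ring_scheme" (structure) +
  assumes finite_carrier: "finite (carrier R)"
begin

text \<open>Cyclicity of the multiplicative group, moved from \<open>mult_of R\<close> to powers in
  R itself. Unit group, squares and cube roots of unity are all read off from exponents of such a
  g.\<close>

lemma mult_of_generator:
  obtains g where "g \<in> carrier R" "g \<noteq> \<zero>"
    and "bij_betw (\<lambda>i::nat. g [^] i) {..<card (carrier R) - 1} (carrier R - {\<zero>})"
    and "\<And>i::nat. g [^] i = \<one> \<longleftrightarrow> card (carrier R) - 1 dvd i"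
proof -
  interpret M: group "mult_of R"
    rewrites "([^]\<^bsub>mult_of R\<^esub>) = (([^]) :: _ \<Rightarrow> nat \<Rightarrow> _)" and "\<one>\<^bsub>mult_of R\<^esub> = \<one>"
    by (rule field_mult_group) (simp_all add: fun_eq_iff nat_pow_def)
  obtain g where g: "g \<in> carrier (mult_of R)"
    and gen: "carrier (mult_of R) = {g [^] i | i::nat. i \<in> UNIV}"
    using finite_field_mult_group_has_gen[OF finite_carrier] by blast
  have fin: "finite (carrier (mult_of R))"
    using finite_carrier by simp
  have pos: "M.ord g > 0"
    using M.ord_ge_1[OF fin g] by simp
  then have set: "{0..M.ord g - 1} = {..<M.ord g}"
    by auto
  have "carrier R - {\<zero>} = (\<lambda>i. g [^] i) ` {..<M.ord g}"
    using M.ord_elems[OF fin g] gen unfolding set by auto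
  moreover have "inj_on (\<lambda>i. g [^] i) {..<M.ord g}"
    using M.ord_inj[OF g] unfolding set .
  ultimately have bij: "bij_betw (\<lambda>i. g [^] i) {..<M.ord g} (carrier R - {\<zero>})"
    by (simp add: bij_betw_def)
  then have "M.ord g = card (carrier R) - 1"
    using bij_betw_same_card[OF bij] finite_carrier by simp
  with that[of g] bij g M.pow_eq_id[OF g] show ?thesis
    by simp
qed

lemma units_of_iso: "units_of R \<cong> integer_mod_group (card (carrier R) - 1)"
proof -
  define n where "n = card (carrier R) - 1"
  obtain g where g: "g \<in> carrier R" "g \<noteq> \<zero>"
    and bij: "bij_betw (\<lambda>i::nat. g [^] i) {..<n} (carrier R - {\<zero>})"
    and ord: "\<And>i::nat. g [^] i = \<one> \<longleftrightarrow> n dvd i"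
    unfolding n_def by (rule mult_of_generator) blast
  interpret U: group "units_of R"
    by (rule units_group)
  have "card {\<zero>, \<one>} \<le> card (carrier R)"
    using finite_carrier by (intro card_mono) auto
  \<comment> \<open>\<open>integer_mod_group 0\<close> is the infinite cyclic group, so positivity
    of q - 1 matters.\<close>
  then have n: "n > 0"
    by (simp add: n_def)
  have mod: "g [^] (i mod n) = g [^] i" for i :: nat
  proof -
    have "g [^] i = g [^] (n * (i div n)) \<otimes> g [^] (i mod n)"
      using g by (simp add: nat_pow_mult)
    moreover have "g [^] (n * (i div n)) = \<one>"
      by (subst ord) simp
    ultimately show ?thesis
      using g by simp
  qed
  have units: "carrier (units_of R) = carrier R - {\<zero>}"
    by (simp add: units_of_carrier field_Units)
  have carrier: "carrier (integer_mod_group n) = int ` {..<n}"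
    using n by (simp add: carrier_integer_mod_group image_int_atLeastLessThan lessThan_atLeast0)
  have "bij_betw nat (int ` {..<n}) {..<n}"
    by (rule bij_betw_byWitness[where f' = int]) auto
  then have b: "bij_betw (\<lambda>i. g [^] nat i) (carrier (integer_mod_group n)) (carrier (units_of R))"
    unfolding carrier units using bij_betw_trans[OF _ bij] by (simp add: comp_def)
  have "(\<lambda>i. g [^] nat i) \<in> iso (integer_mod_group n) (units_of R)"
  proof (intro isoI homI b bij_betw_apply[OF b])
    fix x y assume "x \<in> carrier (integer_mod_group n)" "y \<in> carrier (integer_mod_group n)"
    then obtain i j where ij: "x = int i" "y = int j"
      unfolding carrier by blast
    have "nat ((int i + int j) mod int n) = (i + j) mod n"
      by (simp add: nat_mod_distrib nat_add_distrib)
    then show "g [^] nat (x \<otimes>\<^bsub>integer_mod_group n\<^esub> y) = g [^] nat x \<otimes>\<^bsub>units_of R\<^esub> g [^] nat y"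
      using g by (simp add: ij units_of_mult mod nat_pow_mult)
  qed
  then show ?thesis
    using group.iso_sym[OF group_integer_mod_group] is_isoI unfolding n_def by blast
qed

text \<open>
  There are more than \<open>q / 2\<close> squares, so the sets of the \<open>u\<^sup>2\<close> and of the \<open>-1 - v\<^sup>2\<close> meet.
\<close>

lemma minus_one_sum_of_squares:
  obtains u v where "u \<in> carrier R" "v \<in> carrier R" "u \<otimes> u \<oplus> v \<otimes> v = \<ominus> \<one>"
proof -
  define n where "n = card (carrier R) - 1"
  obtain g where g: "g \<in> carrier R" "g \<noteq> \<zero>"
    and bij: "bij_betw (\<lambda>i::nat. g [^] i) {..<n} (carrier R - {\<zero>})"
    unfolding n_def by (rule mult_of_generator) blast
  define S where "S = (\<lambda>x. x \<otimes> x) ` carrier R"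
  define T where "T = (\<lambda>z. \<ominus> \<one> \<ominus> z) ` S"
  have S: "S \<subseteq> carrier R" and T: "T \<subseteq> carrier R"
    by (auto simp: S_def T_def)
  have "card (carrier R) > 0"
    using finite_carrier by (auto simp: card_gt_0_iff)
  then have q: "card (carrier R) = Suc n"
    by (simp add: n_def)
  \<comment> \<open>With 2 i < n the exponent of the square stays in the range where powers of g are
    distinct. Whatever the parity of n, this yields (n + 1) div 2 nonzero squares; together with
    zero they are more than half of the n + 1 elements.\<close>
  have "inj_on (\<lambda>i. g [^] i \<otimes> g [^] i) {i. i + i < n}"
  proof (rule inj_onI)
    fix i j assume "i \<in> {i. i + i < n}" "j \<in> {i. i + i < n}" "g [^] i \<otimes> g [^] i = g [^] j \<otimes> g [^] j"
    then have "g [^] (i + i) = g [^] (j + j)" "i + i \<in> {..<n}" "j + j \<in> {..<n}"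
      using g by (simp_all add: nat_pow_mult)
    then have "i + i = j + j"
      using bij unfolding bij_betw_def by (meson inj_onD)
    then show "i = j"
      by simp
  qed
  moreover have "\<zero> \<noteq> g [^] i \<otimes> g [^] i" for i :: nat
  proof -
    have "g [^] i \<noteq> \<zero>"
      by (induction i) (use g in \<open>auto simp: integral_iff\<close>)
    then show ?thesis
      using g by (metis integral nat_pow_closed)
  qed
  then have "\<zero> \<notin> (\<lambda>i. g [^] i \<otimes> g [^] i) ` {i. i + i < n}"
    by blast
  moreover have "finite {i. i + i < n}"
    by (rule finite_subset[of _ "{..<n}"]) auto
  ultimately have "card (insert \<zero> ((\<lambda>i. g [^] i \<otimes> g [^] i) ` {i. i + i < n})) = Suc (card {i. i + i < n})"
    by (subst card_insert_disjoint) (auto simp: card_image)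
  also have "{i. i + i < n} = {..<(n + 1) div 2}"
    by auto
  finally have "card (insert \<zero> ((\<lambda>i. g [^] i \<otimes> g [^] i) ` {..<(n + 1) div 2})) = Suc ((n + 1) div 2)"
    by simp
  moreover have "insert \<zero> ((\<lambda>i. g [^] i \<otimes> g [^] i) ` {..<(n + 1) div 2}) \<subseteq> S"
    using g by (auto simp: S_def image_iff intro!: bexI[of _ "\<zero>"])
  ultimately have card: "Suc ((n + 1) div 2) \<le> card S"
    using card_mono[of S] S finite_carrier finite_subset by metis
  have "inj_on (\<lambda>z. \<ominus> \<one> \<ominus> z) S"
    using S by (auto simp: inj_on_def minus_eq subset_iff neg_equal_iff_equal)
  then have "card T = card S"
    by (simp add: T_def card_image)
  have "S \<inter> T \<noteq> {}"
  proof
    assume "S \<inter> T = {}"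
    then have "card (S \<union> T) = card S + card T"
      using S T finite_carrier by (intro card_Un_disjoint) (auto intro: finite_subset)
    also have "\<dots> > card (carrier R)"
      using card \<open>card T = card S\<close> by (subst q) linarith
    finally show False
      using card_mono[OF finite_carrier, of "S \<union> T"] S T by simp
  qed
  then obtain u v where "u \<in> carrier R" "v \<in> carrier R" "u \<otimes> u = \<ominus> \<one> \<ominus> v \<otimes> v"
    by (auto simp: S_def T_def)
  then show ?thesis
    using that[of u v] by (simp add: minus_eq a_assoc l_neg)
qed

text \<open>For a generator g take w = g^((q - 1) / 3). Its exponent is not a multiple of q - 1, so
  w differs from 1, and the factor w - 1 can be cancelled from w^3 - 1 = 0.\<close>

lemma primitive_cube_root_of_unity:
  assumes "3 dvd card (carrier R) - 1"
  obtains w where "w \<in> carrier R" "w \<noteq> \<one>" "w \<otimes> (w \<otimes> w) = \<one>" "\<one> \<oplus> w \<oplus> w \<otimes> w = \<zero>"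
proof -
  define n where "n = card (carrier R) - 1"
  obtain g where g: "g \<in> carrier R" "g \<noteq> \<zero>" and ord: "\<And>i::nat. g [^] i = \<one> \<longleftrightarrow> n dvd i"
    unfolding n_def by (rule mult_of_generator) blast
  have "card {\<zero>, \<one>} \<le> card (carrier R)"
    using finite_carrier by (intro card_mono) auto
  then have n: "n > 0"
    by (simp add: n_def)
  obtain m where m: "n = 3 * m"
    using assms unfolding n_def by blast
  with n have "m > 0" by simp
  define w where "w = g [^] m"
  have w: "w \<in> carrier R" "w \<noteq> \<one>"
    using g ord[of m] m \<open>m > 0\<close> by (auto simp: w_def dest: dvd_imp_le)
  have "w \<otimes> (w \<otimes> w) = g [^] (m + (m + m))"
    using g by (simp add: w_def nat_pow_mult)
  also have "\<dots> = \<one>"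
  proof -
    have "m + (m + m) = n"
      using m by simp
    then show ?thesis
      using ord[of n] by simp
  qed
  finally have cube: "w \<otimes> (w \<otimes> w) = \<one>" .
  have "(w \<ominus> \<one>) \<otimes> (\<one> \<oplus> w \<oplus> w \<otimes> w) = w \<otimes> (w \<otimes> w) \<ominus> \<one>"
    using w by algebra
  also have "\<dots> = \<zero>"
    by (simp add: cube minus_eq r_neg)
  finally have "\<one> \<oplus> w \<oplus> w \<otimes> w = \<zero>"
    using w by (metis add.m_closed integral m_closed minus_closed one_closed r_right_minus_eq)
  with w cube that show ?thesis by blast
qed

text \<open>If 3 is coprime to the order q - 1 of a generator, then q - 1 divides 3 i only if it
  divides i. In the nonsplit case this keeps the primitive cube root found in F_2 out of the image
  of F.\<close>

lemma cube_root_of_unity_trivial: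
  assumes "\<not> 3 dvd card (carrier R) - 1" "a \<in> carrier R" "a \<otimes> (a \<otimes> a) = \<one>"
  shows "a = \<one>"
proof -
  define n where "n = card (carrier R) - 1"
  obtain g where g: "g \<in> carrier R" "g \<noteq> \<zero>"
    and bij: "bij_betw (\<lambda>i::nat. g [^] i) {..<n} (carrier R - {\<zero>})"
    and ord: "\<And>i::nat. g [^] i = \<one> \<longleftrightarrow> n dvd i"
    unfolding n_def by (rule mult_of_generator) blast
  have "a \<noteq> \<zero>"
    using assms by auto
  then have "a \<in> (\<lambda>i. g [^] i) ` {..<n}"
    using bij assms(2) by (simp add: bij_betw_def)
  then obtain i :: nat where i: "a = g [^] i"
    by blast
  have "g [^] (i + (i + i)) = a \<otimes> (a \<otimes> a)"
    using g by (simp add: i nat_pow_mult flip: add.assoc)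
  then have "n dvd i + (i + i)"
    using assms ord by simp
  moreover have "i + (i + i) = 3 * i"
    by simp
  ultimately have "n dvd 3 * i"
    by metis
  moreover have "coprime n 3"
    using assms(1) prime_imp_coprime[of 3 n] unfolding n_def by (simp add: coprime_commute)
  ultimately have "n dvd i"
    using coprime_dvd_mult_right_iff by blast
  then show ?thesis
    using ord i by simp
qed

end

section \<open>Characteristic, and the size of an extension of given degree\<close>

lemma (in field) two_three_neq_zero:
  assumes "ring_char R > 3"
  shows "\<one> \<oplus> \<one> \<noteq> \<zero>" "\<one> \<oplus> \<one> \<oplus> \<one> \<noteq> \<zero>"
proof -
  have "\<not> ring_char R dvd 2" "\<not> ring_char R dvd 3"
    using assms by (auto dest: dvd_imp_le)
  then have "add_pow R (2::nat) \<one> \<noteq> \<zero>" "add_pow R (3::nat) \<one> \<noteq> \<zero>"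
    using add.pow_eq_id[OF one_closed] by (simp_all add: ring_char_def)
  then show "\<one> \<oplus> \<one> \<noteq> \<zero>" "\<one> \<oplus> \<one> \<oplus> \<one> \<noteq> \<zero>"
    by (simp_all add: numeral_2_eq_2 numeral_3_eq_3 add.nat_pow_Suc)
qed

text \<open>Coordinates with respect to a basis exist and are unique, so \<open>combine\<close> is a
  bijection from the lists of length n over K onto E.\<close>

lemma (in ring) card_dimension:
  assumes K: "subfield K R" and "dimension n K E" "finite K"
  shows "finite E" "card E = card K ^ n"
proof -
  obtain Us where Us: "set Us \<subseteq> carrier R" "independent K Us" "length Us = n" "Span K Us = E"
    using exists_base[OF K assms(2)] by blast
  have bij: "bij_betw (\<lambda>Ks. combine Ks Us) {Ks. set Ks \<subseteq> K \<and> length Ks = n} E"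
    unfolding bij_betw_def
  proof
    show image: "(\<lambda>Ks. combine Ks Us) ` {Ks. set Ks \<subseteq> K \<and> length Ks = n} = E"
      using Span_eq_combine_set_length_version[OF K Us(1)] Us(3,4) by auto
    show "inj_on (\<lambda>Ks. combine Ks Us) {Ks. set Ks \<subseteq> K \<and> length Ks = n}"
    proof (rule inj_onI)
      fix Ks Ls assume *: "Ks \<in> {Ks. set Ks \<subseteq> K \<and> length Ks = n}"
        "Ls \<in> {Ks. set Ks \<subseteq> K \<and> length Ks = n}" "combine Ks Us = combine Ls Us"
      then have "combine Ks Us \<in> Span K Us"
        using image Us(4) by blast
      then show "Ks = Ls"
        using unique_decomposition[OF K Us(2)] * Us(3) by (metis (mono_tags, lifting) mem_Collect_eq)
    qed
  qed
  show "finite E" "card E = card K ^ n"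
    using card_lists_length_eq[OF \<open>finite K\<close>, of n] finite_lists_length_eq[OF \<open>finite K\<close>, of n]
      bij_betw_finite[OF bij] bij_betw_same_card[OF bij] by simp_all
qed

lemma card_field_extension_of_degree:
  assumes "field F" "finite (carrier F)" "field_extension_of_degree n F E"
  shows "finite (carrier E)" "card (carrier E) = card (carrier F) ^ n"
proof -
  obtain h where E: "field E" and h: "h \<in> Ring.ring_hom F E"
    and dim: "ring.dimension E n (h ` carrier F) (carrier E)"
    using assms(3) by (auto simp: field_extension_of_degree_def)
  interpret F: field F by fact
  interpret E: field E by fact
  interpret ring_hom_ring F E h
    using h by (intro ring_hom_ringI2) (simp_all add: F.ring_axioms E.ring_axioms)
  have "inj_on h (carrier F)"
    using non_trivial_field_hom_is_inj[OF h F.field_axioms E.field_axioms] .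
  then have "card (h ` carrier F) = card (carrier F)"
    by (rule card_image)
  then show "finite (carrier E)" "card (carrier E) = card (carrier F) ^ n"
    using E.card_dimension[OF img_is_subfield(2)[OF F.carrier_is_subfield E.one_not_zero] dim] assms(2)
    by simp_all
qed

section \<open>The representation map\<close>

abbreviation C3Q8 :: "(int \<times> int_quat) monoid" where
  "C3Q8 \<equiv> integer_mod_group 3 \<times>\<times> Q8"

lemma carrier_C3: "carrier (integer_mod_group 3) = {0, 1, 2}"
  by (auto simp: carrier_integer_mod_group)

lemma group_C3Q8: "group C3Q8"
  by (simp add: DirProd_group group_Q8)

lemma finite_C3Q8: "finite (carrier C3Q8)"
  by (simp add: carrier_C3 Q8_carrier)

lemma card_C3Q8: "card (carrier C3Q8) = 24"
  using order_Q8 by (simp add: carrier_C3 order_def card_cartesian_product)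

text \<open>The multiplicative monoid of F^4 x M_2(F): \<open>product_group\<close> reads only the
  product and the one of the ring record. Its units are F*^4 x GL(2, F).\<close>

definition quat_target :: "('a, 'm) ring_scheme \<Rightarrow> ((nat \<Rightarrow> 'a) \<times> 'a mat) monoid" where
  "quat_target R = product_group {..<4} (\<lambda>_. R) \<times>\<times> mat_monoid 2 R"

text \<open>The map c -> w^c on the representatives 0, 1, 2. It is a character of C_3 once w^3 = 1,
  and w = 1 gives the trivial one.\<close>

definition cube_char :: "('a, 'm) ring_scheme \<Rightarrow> 'a \<Rightarrow> int \<Rightarrow> 'a" where
  "cube_char R w c = (if c = 0 then \<one>\<^bsub>R\<^esub> else if c = 1 then w else w \<otimes>\<^bsub>R\<^esub> w)"

text \<open>The block of FG belonging to one character of C_3: its products with the four linear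
  characters of \<open>Q8\<close>, and its product with the two-dimensional representation. The
  split case uses it for three values of \<open>w\<close> over F, the nonsplit case once over F and
  once over F_2.\<close>

definition quat_map ::
    "('a, 'm) ring_scheme \<Rightarrow> 'a \<Rightarrow> 'a \<Rightarrow> 'a \<Rightarrow> (int \<times> int_quat \<Rightarrow> 'a) \<Rightarrow> (nat \<Rightarrow> 'a) \<times> 'a mat" where
  "quat_map R u v w f =
    (\<lambda>m\<in>{..<4}. pairing R C3Q8 f (\<lambda>(c, x). cube_char R w c \<otimes>\<^bsub>R\<^esub> \<guillemotleft>quat_char m x\<guillemotright>\<^bsub>R\<^esub>),
     mat 2 2 (\<lambda>(i, j). pairing R C3Q8 f (\<lambda>(c, x). cube_char R w c \<otimes>\<^bsub>R\<^esub> quat_entry R u v i j x)))"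

lemma carrier_mat_monoid:
  "carrier (mat_monoid n R) = {A \<in> carrier_mat n n. elements_mat A \<subseteq> carrier R}"
  by (simp add: mat_monoid_def)

lemma mult_mat_monoid:
  "A \<otimes>\<^bsub>mat_monoid n R\<^esub> B =
    mat n n (\<lambda>(i, j). \<Oplus>\<^bsub>R\<^esub>k\<in>{..<n}. A $$ (i, k) \<otimes>\<^bsub>R\<^esub> B $$ (k, j))"
  by (simp add: mat_monoid_def)

lemma one_mat_monoid:
  "\<one>\<^bsub>mat_monoid n R\<^esub> = mat n n (\<lambda>(i, j). if i = j then \<one>\<^bsub>R\<^esub> else \<zero>\<^bsub>R\<^esub>)"
  by (simp add: mat_monoid_def)

lemma mat_in_carrier_mat_monoid:
  assumes "\<And>i j. i < n \<Longrightarrow> j < n \<Longrightarrow> g i j \<in> carrier R"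
  shows "mat n n (\<lambda>(i, j). g i j) \<in> carrier (mat_monoid n R)"
  using assms by (auto simp: carrier_mat_monoid elements_mat_def)

text \<open>Only upper bounds on the target are established; the injection from the group algebra
  supplies the reverse inequality.\<close>

lemma card_mat_monoid_le:
  assumes "finite (carrier R)"
  shows "finite (carrier (mat_monoid n R))"
    and "card (carrier (mat_monoid n R)) \<le> card (carrier R) ^ (n * n)"
proof -
  let ?I = "{..<n} \<times> {..<n}"
  let ?f = "\<lambda>A. \<lambda>p\<in>?I. A $$ p"
  have inj: "inj_on ?f (carrier (mat_monoid n R))"
  proof (rule inj_onI)
    fix A B assume AB: "A \<in> carrier (mat_monoid n R)" "B \<in> carrier (mat_monoid n R)" "?f A = ?f B"
    show "A = B"
    proof (rule eq_matI)
      show "A $$ (i, j) = B $$ (i, j)" if "i < dim_row B" "j < dim_col B" for i j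
        using fun_cong[OF AB(3), of "(i, j)"] AB(1,2) that by (auto simp: carrier_mat_monoid)
    qed (use AB in \<open>auto simp: carrier_mat_monoid\<close>)
  qed
  have sub: "?f ` carrier (mat_monoid n R) \<subseteq> ?I \<rightarrow>\<^sub>E carrier R"
  proof (rule image_subsetI)
    fix A assume "A \<in> carrier (mat_monoid n R)"
    then have "A $$ (i, j) \<in> carrier R" if "i < n" "j < n" for i j
      using that elements_matI[of A n n i j] by (auto simp: carrier_mat_monoid)
    then show "?f A \<in> ?I \<rightarrow>\<^sub>E carrier R"
      by (auto simp: restrict_PiE_iff)
  qed
  have fin: "finite (?I \<rightarrow>\<^sub>E carrier R)"
    using assms by (intro finite_PiE) auto
  show "finite (carrier (mat_monoid n R))"
    using inj_on_finite[OF inj sub fin] .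
  show "card (carrier (mat_monoid n R)) \<le> card (carrier R) ^ (n * n)"
    using card_inj_on_le[OF inj sub fin] by (simp add: card_PiE)
qed

lemma card_quat_target_le:
  assumes "finite (carrier R)"
  shows "finite (carrier (quat_target R))"
    and "card (carrier (quat_target R)) \<le> card (carrier R) ^ 8"
proof -
  show "finite (carrier (quat_target R))"
    using assms card_mat_monoid_le(1)[OF assms, of 2] by (auto simp: quat_target_def intro!: finite_PiE)
  have "card (carrier (quat_target R)) = card (carrier R) ^ 4 * card (carrier (mat_monoid 2 R))"
    by (simp add: quat_target_def card_cartesian_product card_PiE)
  also have "\<dots> \<le> card (carrier R) ^ 4 * card (carrier R) ^ 4"
    using card_mat_monoid_le(2)[OF assms, of 2] by (intro mult_le_mono2) simp
  also have "\<dots> = card (carrier R) ^ 8"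
    by (simp flip: power_add)
  finally show "card (carrier (quat_target R)) \<le> card (carrier R) ^ 8" .
qed

lemma (in abelian_monoid) finsum_lessThan_2:
  assumes "f 0 \<in> carrier G" "f 1 \<in> carrier G"
  shows "(\<Oplus>k\<in>{..<2::nat}. f k) = f 0 \<oplus> f 1"
proof -
  have "{..<2::nat} = {0, 1}"
    by auto
  then show ?thesis
    using assms by simp
qed

text \<open>Fixes one solution of u^2 + v^2 = -1. In the nonsplit case it is interpreted over F and
  over F_2 with unrelated solutions; the two blocks are separate factors of the target, so the
  choices need not match.\<close>

locale quat_field = finite_field R for R :: "('a, 'm) ring_scheme" (structure) +
  fixes u v :: 'a
  assumes two: "\<one> \<oplus> \<one> \<noteq> \<zero>"
    and u_mem: "u \<in> carrier R" and v_mem: "v \<in> carrier R"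
    and uv: "u \<otimes> u \<oplus> v \<otimes> v = \<ominus> \<one>"
begin

sublocale finite_group_algebra R C3Q8
  by (intro finite_group_algebra.intro finite_group_algebra_axioms.intro cring_axioms
      group_C3Q8 finite_C3Q8)

lemma cube_char_closed [simp]: "w \<in> carrier R \<Longrightarrow> cube_char R w c \<in> carrier R"
  by (simp add: cube_char_def)

lemma cube_char_zero: "cube_char R w 0 = \<one>"
  by (simp add: cube_char_def)

lemma cube_char_mult:
  assumes "w \<in> carrier R" "w \<otimes> (w \<otimes> w) = \<one>"
    and "c \<in> carrier (integer_mod_group 3)" "d \<in> carrier (integer_mod_group 3)"
  shows "cube_char R w (c \<otimes>\<^bsub>integer_mod_group 3\<^esub> d) = cube_char R w c \<otimes> cube_char R w d"
  using assms by (auto simp: carrier_C3 cube_char_def m_assoc)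

lemma twist_closed:
  assumes "w \<in> carrier R" "s \<in> carrier Q8 \<rightarrow> carrier R"
  shows "(\<lambda>(c, x). cube_char R w c \<otimes> s x) \<in> carrier C3Q8 \<rightarrow> carrier R"
  using assms by auto

lemma char_twist_closed:
  "w \<in> carrier R \<Longrightarrow> (\<lambda>(c, x). cube_char R w c \<otimes> \<guillemotleft>quat_char m x\<guillemotright>) \<in> carrier C3Q8 \<rightarrow> carrier R"
  by (intro twist_closed) auto

lemma entry_twist_closed:
  "w \<in> carrier R \<Longrightarrow> (\<lambda>(c, x). cube_char R w c \<otimes> quat_entry R u v i j x) \<in> carrier C3Q8 \<rightarrow> carrier R"
  using u_mem v_mem by (intro twist_closed) auto

lemma twist_mult:
  assumes w: "w \<in> carrier R" "w \<otimes> (w \<otimes> w) = \<one>"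
    and s: "s \<in> carrier Q8 \<rightarrow> carrier R" "t \<in> carrier Q8 \<rightarrow> carrier R"
    and cx: "(c, x) \<in> carrier C3Q8" and dy: "(d, y) \<in> carrier C3Q8"
  shows "(cube_char R w c \<otimes> s x) \<otimes> (cube_char R w d \<otimes> t y) =
    cube_char R w (c \<otimes>\<^bsub>integer_mod_group 3\<^esub> d) \<otimes> (s x \<otimes> t y)"
proof -
  have "s x \<in> carrier R" "t y \<in> carrier R" "cube_char R w c \<in> carrier R" "cube_char R w d \<in> carrier R"
    using s w cx dy by auto
  then show ?thesis
    using cx dy by (simp add: cube_char_mult[OF w] m_ac del: mult_integer_mod_group)
qed

lemma quat_map_closed:
  assumes w: "w \<in> carrier R" and f: "f \<in> carrier A"
  shows "quat_map R u v w f \<in> carrier (quat_target R)"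
proof -
  have f': "f \<in> carrier C3Q8 \<rightarrow> carrier R"
    using f by (auto simp: carrier_group_algebra)
  show ?thesis
    unfolding quat_map_def quat_target_def carrier_DirProd
    using pairing_closed[OF f' char_twist_closed[OF w]] pairing_closed[OF f' entry_twist_closed[OF w]]
    by (intro SigmaI mat_in_carrier_mat_monoid) auto
qed

lemma quat_map_one:
  assumes w: "w \<in> carrier R"
  shows "quat_map R u v w \<one>\<^bsub>A\<^esub> = \<one>\<^bsub>quat_target R\<^esub>"
proof -
  have "quat_char m \<one>\<^bsub>Q8\<^esub> = 1" for m
    by (rule quat_char_one)
  moreover have "quat_entry R u v i j \<one>\<^bsub>Q8\<^esub> = (if i = j then \<one> else \<zero>)" if "i < 2" "j < 2" for i j
    using quat_entry_one[OF u_mem v_mem that] .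
  ultimately show ?thesis
    unfolding quat_map_def quat_target_def one_DirProd one_mat_monoid using w
    by (auto simp: cube_char_zero pairing_one[OF char_twist_closed[OF w]] pairing_one[OF entry_twist_closed[OF w]]
        intro!: restrict_ext)
qed

lemma quat_map_mult:
  assumes w: "w \<in> carrier R" "w \<otimes> (w \<otimes> w) = \<one>"
    and f: "f \<in> carrier A" and g: "g \<in> carrier A"
  shows "quat_map R u v w (f \<otimes>\<^bsub>A\<^esub> g) = quat_map R u v w f \<otimes>\<^bsub>quat_target R\<^esub> quat_map R u v w g"
proof -
  let ?c = "\<lambda>m (c, x). cube_char R w c \<otimes> \<guillemotleft>quat_char m x\<guillemotright>"
  let ?e = "\<lambda>i j (c, x). cube_char R w c \<otimes> quat_entry R u v i j x"
  have "pairing R C3Q8 (f \<otimes>\<^bsub>A\<^esub> g) (?c m) = pairing R C3Q8 f (?c m) \<otimes> pairing R C3Q8 g (?c m)" for m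
  proof (rule pairing_mult_character[OF f g char_twist_closed[OF w(1)]])
    fix p q assume "p \<in> carrier C3Q8" "q \<in> carrier C3Q8"
    then show "?c m (p \<otimes>\<^bsub>C3Q8\<^esub> q) = ?c m p \<otimes> ?c m q"
      using twist_mult[OF w, of "\<lambda>x. \<guillemotleft>quat_char m x\<guillemotright>" "\<lambda>x. \<guillemotleft>quat_char m x\<guillemotright>"]
      by (cases p; cases q)
         (simp add: quat_char_mult del: mult_integer_mod_group quat_char.simps split_paired_All)
  qed
  moreover have "pairing R C3Q8 (f \<otimes>\<^bsub>A\<^esub> g) (?e i j) =
      (\<Oplus>k\<in>{..<2}. pairing R C3Q8 f (?e i k) \<otimes> pairing R C3Q8 g (?e k j))" if "i < 2" "j < 2" for i j
  proof (rule pairing_mult_sum[OF f g _ entry_twist_closed[OF w(1)] entry_twist_closed[OF w(1)]])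
    fix p q assume pq: "p \<in> carrier C3Q8" "q \<in> carrier C3Q8"
    obtain c x d y where p: "p = (c, x)" and q: "q = (d, y)"
      by (cases p; cases q) blast
    let ?z = "cube_char R w (c \<otimes>\<^bsub>integer_mod_group 3\<^esub> d)"
    \<comment> \<open>The scalar \<open>?z\<close> depends on c and d but not on the summation
      index, so it factors out of the matrix product.\<close>
    have k: "?e i k p \<otimes> ?e k j q = ?z \<otimes> (quat_entry R u v i k x \<otimes> quat_entry R u v k j y)" for k
      using twist_mult[OF w, of "quat_entry R u v i k" "quat_entry R u v k j"] pq u_mem v_mem
      by (simp add: p q del: mult_integer_mod_group)
    have "?e i j (p \<otimes>\<^bsub>C3Q8\<^esub> q) = ?e i 0 p \<otimes> ?e 0 j q \<oplus> ?e i 1 p \<otimes> ?e 1 j q"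
      unfolding k using pq w u_mem v_mem that
      by (simp add: p q quat_entry_mult[OF u_mem v_mem uv] r_distr del: mult_integer_mod_group quat_entry.simps)
    also have "\<dots> = (\<Oplus>k\<in>{..<2}. ?e i k p \<otimes> ?e k j q)"
      using w u_mem v_mem by (subst finsum_lessThan_2) (simp_all add: p q)
    finally show "?e i j (p \<otimes>\<^bsub>C3Q8\<^esub> q) = \<dots>" .
  qed simp
  moreover have "pairing R C3Q8 h (?e i j) \<in> carrier R" if "h \<in> carrier A" for h i j
    using that by (intro pairing_closed entry_twist_closed w) (simp add: carrier_group_algebra PiE_def)
  ultimately show ?thesis
    unfolding quat_map_def quat_target_def mult_DirProd mult_mat_monoid using f g
    by (auto intro!: restrict_ext simp: finsum_lessThan_2)
qed

text \<open>Summing over C_3 first evaluates the generator of C_3 at \<open>w\<close>: viewing FG as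
  the group algebra of Q_8 over FC_3, only its image in the group algebra of Q_8 over the field is
  left to be paired.\<close>

lemma pairing_twist:
  assumes w: "w \<in> carrier R" and s: "s \<in> carrier Q8 \<rightarrow> carrier R" and h: "h \<in> carrier C3Q8 \<rightarrow> carrier R"
  shows "pairing R C3Q8 h (\<lambda>(c, x). cube_char R w c \<otimes> s x) =
    pairing R Q8 (\<lambda>x. h (0, x) \<oplus> (h (1, x) \<otimes> w \<oplus> h (2, x) \<otimes> (w \<otimes> w))) s"
proof -
  have h': "h (c, x) \<in> carrier R" if "c \<in> {0, 1, 2}" "x \<in> carrier Q8" for c x
    using h that by (auto simp: carrier_C3)
  have s': "s x \<in> carrier R" if "x \<in> carrier Q8" for x
    using s that by auto
  have fin: "finite (carrier Q8)"
    by (simp add: Q8_carrier)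
  have "pairing R C3Q8 h (\<lambda>(c, x). cube_char R w c \<otimes> s x) =
      (\<Oplus>c\<in>{0, 1, 2}. \<Oplus>x\<in>carrier Q8. h (c, x) \<otimes> (cube_char R w c \<otimes> s x))"
    unfolding pairing_def carrier_DirProd carrier_C3 using h' s' w fin
    by (subst finsum_Times) auto
  also have "\<dots> = (\<Oplus>x\<in>carrier Q8. \<Oplus>c\<in>{0, 1, 2}. h (c, x) \<otimes> (cube_char R w c \<otimes> s x))"
    using h' s' w fin by (intro finsum_swap) auto
  also have "\<dots> = pairing R Q8 (\<lambda>x. h (0, x) \<oplus> (h (1, x) \<otimes> w \<oplus> h (2, x) \<otimes> (w \<otimes> w))) s"
    unfolding pairing_def
  proof (rule finsum_cong'[OF refl])
    fix x assume x: "x \<in> carrier Q8"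
    show "(\<Oplus>c\<in>{0, 1, 2}. h (c, x) \<otimes> (cube_char R w c \<otimes> s x)) =
        (h (0, x) \<oplus> (h (1, x) \<otimes> w \<oplus> h (2, x) \<otimes> (w \<otimes> w))) \<otimes> s x"
      using h'[OF _ x] s'[OF x] w by (simp add: cube_char_def l_distr m_assoc)
  qed (use h' s' w in auto)
  finally show ?thesis .
qed

text \<open>By \<open>quat_kernel\<close>, the block at \<open>w\<close> determines the collapsed
  function on \<open>Q8\<close>, that is, one linear combination of the three coefficients over each
  x. Separating the three coefficients is the task of combining several blocks.\<close>

lemma quat_map_eqD:
  assumes w: "w \<in> carrier R"
    and f: "f \<in> carrier A" and g: "g \<in> carrier A"
    and eq: "quat_map R u v w f = quat_map R u v w g"
    and x: "x \<in> carrier Q8"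
  shows "(f (0, x) \<ominus> g (0, x)) \<oplus> ((f (1, x) \<ominus> g (1, x)) \<otimes> w \<oplus> (f (2, x) \<ominus> g (2, x)) \<otimes> (w \<otimes> w)) = \<zero>"
proof -
  define h where "h p = f p \<ominus> g p" for p
  have f': "f \<in> carrier C3Q8 \<rightarrow> carrier R" and g': "g \<in> carrier C3Q8 \<rightarrow> carrier R"
    using f g by (auto simp: carrier_group_algebra)
  then have h: "h \<in> carrier C3Q8 \<rightarrow> carrier R"
    unfolding h_def by (intro funcsetI minus_closed) (blast dest: funcset_mem)+
  have mem: "h (c, x) \<in> carrier R" if "c \<in> {0, 1, 2}" "x \<in> carrier Q8" for c x
    using h that by (auto simp: carrier_C3)
  have zero: "pairing R C3Q8 h r = \<zero>"
    if "pairing R C3Q8 f r = pairing R C3Q8 g r" "r \<in> carrier C3Q8 \<rightarrow> carrier R" for r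
    unfolding h_def using that f' g' by (simp add: pairing_diff)
  have "h (0, x) \<oplus> (h (1, x) \<otimes> w \<oplus> h (2, x) \<otimes> (w \<otimes> w)) = \<zero>"
  proof (rule quat_kernel[OF two u_mem v_mem uv _ _ _ x])
    show "(\<lambda>x. h (0, x) \<oplus> (h (1, x) \<otimes> w \<oplus> h (2, x) \<otimes> (w \<otimes> w))) \<in> carrier Q8 \<rightarrow> carrier R"
      using mem w by auto
    show "pairing R Q8 (\<lambda>x. h (0, x) \<oplus> (h (1, x) \<otimes> w \<oplus> h (2, x) \<otimes> (w \<otimes> w))) (\<lambda>x. \<guillemotleft>quat_char m x\<guillemotright>) = \<zero>"
      if "m < 4" for m
    proof (subst pairing_twist[OF w _ h, symmetric])
      show "pairing R C3Q8 h (\<lambda>(c, x). cube_char R w c \<otimes> \<guillemotleft>quat_char m x\<guillemotright>) = \<zero>"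
        using fun_cong[OF arg_cong[OF eq, of fst], of m] that
        by (intro zero char_twist_closed[OF w]) (simp add: quat_map_def)
    qed simp
    show "pairing R Q8 (\<lambda>x. h (0, x) \<oplus> (h (1, x) \<otimes> w \<oplus> h (2, x) \<otimes> (w \<otimes> w))) (quat_entry R u v i j) = \<zero>"
      if "i < 2" "j < 2" for i j
    proof (subst pairing_twist[OF w _ h, symmetric])
      show "pairing R C3Q8 h (\<lambda>(c, x). cube_char R w c \<otimes> quat_entry R u v i j x) = \<zero>"
        using arg_cong[OF eq, of "\<lambda>y. snd y $$ (i, j)"] that
        by (intro zero entry_twist_closed[OF w]) (simp add: quat_map_def)
    qed (use u_mem v_mem in simp)
  qed
  then show ?thesis
    by (simp add: h_def)
qed

lemma units_of_quat_target:
  "units_of (quat_target R) \<cong>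
    group_power (integer_mod_group (card (carrier R) - 1)) 4 \<times>\<times> GL 2 R"
proof -
  have eq: "units_of (quat_target R) = group_power (units_of R) 4 \<times>\<times> GL 2 R"
    by (simp add: quat_target_def units_of_DirProd units_of_product_group GL_def group_power_def)
  show ?thesis
    unfolding eq by (rule DirProd_cong[OF group_power_cong[OF units_of_iso] iso_refl])
qed

end

section \<open>The unit group\<close>

text \<open>Fourier inversion on C_3. Adding the three equations gives 3 a = 0, since 1 + w + w^2 =
  0; then b = -c and c w (w - 1) = 0.\<close>

lemma (in domain) cube_characters_kernel:
  assumes three: "\<one> \<oplus> \<one> \<oplus> \<one> \<noteq> \<zero>"
    and w: "w \<in> carrier R" "w \<noteq> \<one>" "w \<otimes> (w \<otimes> w) = \<one>" "\<one> \<oplus> w \<oplus> w \<otimes> w = \<zero>"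
    and mem: "a \<in> carrier R" "b \<in> carrier R" "c \<in> carrier R"
    and eq: "a \<oplus> (b \<oplus> c) = \<zero>" "a \<oplus> (b \<otimes> w \<oplus> c \<otimes> (w \<otimes> w)) = \<zero>"
      "a \<oplus> (b \<otimes> (w \<otimes> w) \<oplus> c \<otimes> w) = \<zero>"
  shows "a = \<zero>" "b = \<zero>" "c = \<zero>"
proof -
  \<comment> \<open>The second summand on the left vanishes, but with it the equation is a
    polynomial identity in w, valid before 1 + w + w^2 = 0 is used.\<close>
  have "(\<one> \<oplus> \<one> \<oplus> \<one>) \<otimes> a \<oplus> (b \<oplus> c) \<otimes> (\<one> \<oplus> w \<oplus> w \<otimes> w) =
      (a \<oplus> (b \<oplus> c)) \<oplus> ((a \<oplus> (b \<otimes> w \<oplus> c \<otimes> (w \<otimes> w))) \<oplus> (a \<oplus> (b \<otimes> (w \<otimes> w) \<oplus> c \<otimes> w)))"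
    using w(1) mem by algebra
  then have "(\<one> \<oplus> \<one> \<oplus> \<one>) \<otimes> a = \<zero>"
    using mem unfolding eq w(4) by simp
  then show a: "a = \<zero>"
    using three mem integral by blast
  then have b: "b = \<ominus> c"
    using eq(1) mem by (simp add: sum_zero_eq_neg)
  have "c \<otimes> (w \<otimes> (w \<ominus> \<one>)) = a \<oplus> (b \<otimes> w \<oplus> c \<otimes> (w \<otimes> w))"
    unfolding a b using w(1) mem by algebra
  then have "c \<otimes> (w \<otimes> (w \<ominus> \<one>)) = \<zero>"
    by (simp add: eq)
  moreover have "w \<noteq> \<zero>" "w \<ominus> \<one> \<noteq> \<zero>"
    using w by auto
  ultimately show "c = \<zero>"
    using w(1) mem by (simp add: integral_iff)
  with b show "b = \<zero>"
    by simp
qed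

lemma bij_betw_if_card_le:
  assumes "inj_on f X" "f ` X \<subseteq> Y" "finite Y" "card Y \<le> card X"
  shows "bij_betw f X Y"
  using assms by (simp add: bij_betw_def card_image card_seteq)

lemma card_group_algebra_C3Q8:
  "card (carrier (group_algebra R C3Q8)) = card (carrier R) ^ 24"
  using finite_C3Q8 card_C3Q8 by (simp add: carrier_group_algebra card_PiE)

lemma group_algebra_C3Q8_eqI:
  assumes "f \<in> carrier (group_algebra R C3Q8)" "g \<in> carrier (group_algebra R C3Q8)"
    and "\<And>x. x \<in> carrier Q8 \<Longrightarrow> f (0, x) = g (0, x) \<and> f (1, x) = g (1, x) \<and> f (2, x) = g (2, x)"
  shows "f = g"
proof (rule PiE_ext)
  show "f \<in> carrier C3Q8 \<rightarrow>\<^sub>E carrier R" "g \<in> carrier C3Q8 \<rightarrow>\<^sub>E carrier R"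
    using assms(1,2) by (simp_all add: carrier_group_algebra)
  show "f p = g p" if "p \<in> carrier C3Q8" for p
    using that assms(3)[of "snd p"] by (cases p) (auto simp: carrier_C3)
qed

section \<open>The split case: three blocks over the same field\<close>

context quat_field
begin

lemma units_of_group_algebra_split:
  assumes three: "\<one> \<oplus> \<one> \<oplus> \<one> \<noteq> \<zero>"
    and w: "w \<in> carrier R" "w \<noteq> \<one>" "w \<otimes> (w \<otimes> w) = \<one>" "\<one> \<oplus> w \<oplus> w \<otimes> w = \<zero>"
  shows "units_of A \<cong>
    group_power (integer_mod_group (card (carrier R) - 1)) 12 \<times>\<times> group_power (GL 2 R) 3"
proof -
  \<comment> \<open>\<open>cube_char\<close> serves here to list the cube roots of unity 1, w, w^2.
    Beyond index 2 it stays at w^2, so \<open>z_mem\<close> and \<open>z_cube\<close> hold for every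
    index.\<close>
  define z where "z i = cube_char R w (int i)" for i
  have z: "z 0 = \<one>" "z 1 = w" "z (Suc 0) = w" "z 2 = w \<otimes> w"
    by (simp_all add: z_def cube_char_def)
  have zw: "(w \<otimes> w) \<otimes> (w \<otimes> w) = w"
    using w(1,3) by (simp add: m_assoc)
  have z_mem: "z i \<in> carrier R" for i
    using w(1) by (simp add: z_def)
  have z_cube: "z i \<otimes> (z i \<otimes> z i) = \<one>" for i
  proof -
    have "(w \<otimes> w) \<otimes> ((w \<otimes> w) \<otimes> (w \<otimes> w)) = \<one>"
      unfolding zw using w(1,3) by (simp add: m_assoc)
    then show ?thesis
      using w by (simp add: z_def cube_char_def)
  qed
  define \<phi> where "\<phi> f = (\<lambda>i\<in>{..<3::nat}. quat_map R u v (z i) f)" for f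
  let ?T = "group_power (quat_target R) 3"
  have inj: "inj_on \<phi> (carrier A)"
  proof (rule inj_onI)
    fix f g assume f: "f \<in> carrier A" and g: "g \<in> carrier A" and eq: "\<phi> f = \<phi> g"
    have map_eq: "quat_map R u v (z i) f = quat_map R u v (z i) g" if "i < 3" for i
      using fun_cong[OF eq, of i] that by (simp add: \<phi>_def)
    show "f = g"
    proof (rule group_algebra_C3Q8_eqI[OF f g])
      fix x assume x: "x \<in> carrier Q8"
      have fg: "f (c, x) \<in> carrier R" "g (c, x) \<in> carrier R" if "c \<in> {0, 1, 2}" for c
        using group_algebra_mem[OF f] group_algebra_mem[OF g] x that by (simp_all add: carrier_C3)
      define d where "d c = f (c, x) \<ominus> g (c, x)" for c
      have d: "d 0 \<in> carrier R" "d 1 \<in> carrier R" "d 2 \<in> carrier R"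
        using fg by (simp_all add: d_def)
      have "d 0 \<oplus> (d 1 \<otimes> z i \<oplus> d 2 \<otimes> (z i \<otimes> z i)) = \<zero>" if "i < 3" for i
        unfolding d_def using quat_map_eqD[OF z_mem f g map_eq[OF that] x] .
      from this[of 0] this[of 1] this[of 2] have "d 0 = \<zero>" "d 1 = \<zero>" "d 2 = \<zero>"
        using cube_characters_kernel[OF three w d] d by (simp_all add: z zw)
      then show "f (0, x) = g (0, x) \<and> f (1, x) = g (1, x) \<and> f (2, x) = g (2, x)"
        using fg by (simp add: d_def)
    qed
  qed
  have image: "\<phi> ` carrier A \<subseteq> carrier ?T"
    using quat_map_closed[OF z_mem] unfolding \<phi>_def group_power_def
    by (intro image_subsetI) (simp add: restrict_PiE_iff)
  have T_card: "card (carrier ?T) \<le> card (carrier A)"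
  proof -
    have "card (carrier ?T) = card (carrier (quat_target R)) ^ 3"
      by (simp add: group_power_def card_PiE)
    also have "\<dots> \<le> (card (carrier R) ^ 8) ^ 3"
      using card_quat_target_le(2)[OF finite_carrier] by (rule power_mono) simp
    finally show ?thesis
      by (simp add: card_group_algebra_C3Q8 flip: power_mult)
  qed
  have "finite (carrier ?T)"
    using card_quat_target_le(1)[OF finite_carrier] by (simp add: group_power_def finite_PiE)
  with inj image T_card have bij: "bij_betw \<phi> (carrier A) (carrier ?T)"
    by (intro bij_betw_if_card_le)
  have "\<phi> (f \<otimes>\<^bsub>A\<^esub> g) = \<phi> f \<otimes>\<^bsub>?T\<^esub> \<phi> g" if "f \<in> carrier A" "g \<in> carrier A" for f g
    using quat_map_mult[OF z_mem z_cube that] by (auto simp: \<phi>_def group_power_def intro!: restrict_ext)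
  then have iso: "\<phi> \<in> iso A ?T"
    using bij by (intro isoI homI bij_betw_apply[OF bij])
  have one: "\<phi> \<one>\<^bsub>A\<^esub> = \<one>\<^bsub>?T\<^esub>"
    using quat_map_one[OF z_mem] by (auto simp: \<phi>_def group_power_def intro!: restrict_ext)
  have "units_of A \<cong> units_of ?T"
    by (rule units_of_cong[OF iso]) (auto simp: one intro: one_group_algebra_closed group_algebra_closed)
  also have "units_of ?T = group_power (units_of (quat_target R)) 3"
    by (simp add: group_power_def units_of_product_group)
  also have "\<dots> \<cong> group_power
      (group_power (integer_mod_group (card (carrier R) - 1)) 4 \<times>\<times> GL 2 R) 3"
    by (rule group_power_cong[OF units_of_quat_target])
  also have "\<dots> \<cong> group_power (group_power (integer_mod_group (card (carrier R) - 1)) 4) 3 \<times>\<times>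
      group_power (GL 2 R) 3"
    by (rule group_power_DirProd)
  also have "\<dots> \<cong> group_power (integer_mod_group (card (carrier R) - 1)) (3 * 4) \<times>\<times>
      group_power (GL 2 R) 3"
    by (rule DirProd_cong[OF group_power_group_power iso_refl])
  finally show ?thesis
    by simp
qed

end

section \<open>The nonsplit case: extension of scalars and one block over the quadratic
  extension\<close>

lemma group_algebra_map_mult:
  assumes "ring_hom_cring F E h" "group G"
    and "f \<in> carrier (group_algebra F G)" "g \<in> carrier (group_algebra F G)"
  defines "H \<equiv> \<lambda>f. \<lambda>x\<in>carrier G. h (f x)"
  shows "H (f \<otimes>\<^bsub>group_algebra F G\<^esub> g) = H f \<otimes>\<^bsub>group_algebra E G\<^esub> H g"
proof -
  interpret ring_hom_cring F E h by fact
  interpret G: group G by fact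
  have mem: "f x \<in> carrier F" "g x \<in> carrier F" if "x \<in> carrier G" for x
    using assms(3,4) that by (auto simp: carrier_group_algebra)
  have "h (\<Oplus>\<^bsub>F\<^esub>y\<in>carrier G. f y \<otimes>\<^bsub>F\<^esub> g (inv\<^bsub>G\<^esub> y \<otimes>\<^bsub>G\<^esub> x)) =
      (\<Oplus>\<^bsub>E\<^esub>y\<in>carrier G. H f y \<otimes>\<^bsub>E\<^esub> H g (inv\<^bsub>G\<^esub> y \<otimes>\<^bsub>G\<^esub> x))" if x: "x \<in> carrier G" for x
  proof -
    have "h (\<Oplus>\<^bsub>F\<^esub>y\<in>carrier G. f y \<otimes>\<^bsub>F\<^esub> g (inv\<^bsub>G\<^esub> y \<otimes>\<^bsub>G\<^esub> x)) =
        (\<Oplus>\<^bsub>E\<^esub>y\<in>carrier G. (h \<circ> (\<lambda>y. f y \<otimes>\<^bsub>F\<^esub> g (inv\<^bsub>G\<^esub> y \<otimes>\<^bsub>G\<^esub> x))) y)"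
      using mem x by (intro hom_finsum) auto
    also have "\<dots> = (\<Oplus>\<^bsub>E\<^esub>y\<in>carrier G. H f y \<otimes>\<^bsub>E\<^esub> H g (inv\<^bsub>G\<^esub> y \<otimes>\<^bsub>G\<^esub> x))"
      using mem x by (intro S.finsum_cong') (auto simp: H_def)
    finally show ?thesis .
  qed
  then show ?thesis
    by (auto simp: mult_group_algebra H_def intro!: restrict_ext)
qed

text \<open>Eliminating w^2 = -1 - w turns the relation into (a - c) + (b - c) w = 0, and 1 and w
  are linearly independent over F because w is not in its image. What survives is a = b = c, which
  the trivial character then has to detect.\<close>

lemma quadratic_relation_kernel:
  assumes F: "field F" and E: "field E" and h: "h \<in> Ring.ring_hom F E"
    and w: "w \<in> carrier E" "\<one>\<^bsub>E\<^esub> \<oplus>\<^bsub>E\<^esub> w \<oplus>\<^bsub>E\<^esub> w \<otimes>\<^bsub>E\<^esub> w = \<zero>\<^bsub>E\<^esub>" "w \<notin> h ` carrier F"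
    and mem: "a \<in> carrier F" "b \<in> carrier F" "c \<in> carrier F"
    and eq: "h a \<oplus>\<^bsub>E\<^esub> (h b \<otimes>\<^bsub>E\<^esub> w \<oplus>\<^bsub>E\<^esub> h c \<otimes>\<^bsub>E\<^esub> (w \<otimes>\<^bsub>E\<^esub> w)) = \<zero>\<^bsub>E\<^esub>"
  shows "a = c" "b = c"
proof -
  interpret F: field F by fact
  interpret E: field E by fact
  interpret ring_hom_cring F E h
    using h by (intro ring_hom_cring.intro ring_hom_cring_axioms.intro F.is_cring E.is_cring)
  have inj: "inj_on h (carrier F)"
    using non_trivial_field_hom_is_inj[OF h F E] .
  let ?r = "a \<ominus>\<^bsub>F\<^esub> c" and ?s = "b \<ominus>\<^bsub>F\<^esub> c"
  have h_mem: "h a \<in> carrier E" "h b \<in> carrier E" "h c \<in> carrier E"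
    using mem by simp_all
  have rs_mem: "?r \<in> carrier F" "?s \<in> carrier F"
    using mem by simp_all
  have "h ?r \<oplus>\<^bsub>E\<^esub> h ?s \<otimes>\<^bsub>E\<^esub> w = (h a \<ominus>\<^bsub>E\<^esub> h c) \<oplus>\<^bsub>E\<^esub> (h b \<ominus>\<^bsub>E\<^esub> h c) \<otimes>\<^bsub>E\<^esub> w"
    using mem by (simp add: F.minus_eq E.minus_eq)
  also have "\<dots> = (h a \<oplus>\<^bsub>E\<^esub> (h b \<otimes>\<^bsub>E\<^esub> w \<oplus>\<^bsub>E\<^esub> h c \<otimes>\<^bsub>E\<^esub> (w \<otimes>\<^bsub>E\<^esub> w)))
      \<ominus>\<^bsub>E\<^esub> h c \<otimes>\<^bsub>E\<^esub> (\<one>\<^bsub>E\<^esub> \<oplus>\<^bsub>E\<^esub> w \<oplus>\<^bsub>E\<^esub> w \<otimes>\<^bsub>E\<^esub> w)"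
    using h_mem w(1) by algebra
  also have "\<dots> = \<zero>\<^bsub>E\<^esub>"
    using h_mem unfolding eq w(2) by (simp add: E.minus_eq)
  finally have zero: "h ?r \<oplus>\<^bsub>E\<^esub> h ?s \<otimes>\<^bsub>E\<^esub> w = \<zero>\<^bsub>E\<^esub>" .
  have s0: "?s = \<zero>\<^bsub>F\<^esub>"
  proof (rule ccontr)
    assume s: "?s \<noteq> \<zero>\<^bsub>F\<^esub>"
    then have inv: "inv\<^bsub>F\<^esub> ?s \<in> carrier F" "inv\<^bsub>F\<^esub> ?s \<otimes>\<^bsub>F\<^esub> ?s = \<one>\<^bsub>F\<^esub>"
      using rs_mem F.field_Units by simp_all
    have "h (\<ominus>\<^bsub>F\<^esub> (inv\<^bsub>F\<^esub> ?s \<otimes>\<^bsub>F\<^esub> ?r)) = \<ominus>\<^bsub>E\<^esub> (h (inv\<^bsub>F\<^esub> ?s) \<otimes>\<^bsub>E\<^esub> h ?r)"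
      using inv rs_mem by simp
    also have "h ?r = \<ominus>\<^bsub>E\<^esub> (h ?s \<otimes>\<^bsub>E\<^esub> w)"
      using rs_mem w(1) by (intro E.sum_zero_eq_neg[OF _ _ zero] hom_closed E.m_closed)
    also have "\<ominus>\<^bsub>E\<^esub> (h (inv\<^bsub>F\<^esub> ?s) \<otimes>\<^bsub>E\<^esub> \<ominus>\<^bsub>E\<^esub> (h ?s \<otimes>\<^bsub>E\<^esub> w)) = h (inv\<^bsub>F\<^esub> ?s \<otimes>\<^bsub>F\<^esub> ?s) \<otimes>\<^bsub>E\<^esub> w"
      using inv(1) rs_mem w(1) by (simp only: hom_mult E.r_minus E.m_assoc E.minus_minus hom_closed E.m_closed)
    also have "\<dots> = w"
      unfolding inv(2) using w(1) by simp
    finally have "w = h (\<ominus>\<^bsub>F\<^esub> (inv\<^bsub>F\<^esub> ?s \<otimes>\<^bsub>F\<^esub> ?r))" ..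
    moreover have "\<ominus>\<^bsub>F\<^esub> (inv\<^bsub>F\<^esub> ?s \<otimes>\<^bsub>F\<^esub> ?r) \<in> carrier F"
      using inv(1) rs_mem by simp
    ultimately show False
      using w(3) by blast
  qed
  then have "h ?r = h \<zero>\<^bsub>F\<^esub>"
    using zero w(1) rs_mem by simp
  then have "?r = \<zero>\<^bsub>F\<^esub>"
    using inj_onD[OF inj] rs_mem F.zero_closed by blast
  with s0 show "a = c" "b = c"
    using mem by simp_all
qed

lemma units_of_group_algebra_nonsplit:
  assumes F: "quat_field F u v" and E: "quat_field E u' v'" and h: "h \<in> Ring.ring_hom F E"
    and three: "\<one>\<^bsub>F\<^esub> \<oplus>\<^bsub>F\<^esub> \<one>\<^bsub>F\<^esub> \<oplus>\<^bsub>F\<^esub> \<one>\<^bsub>F\<^esub> \<noteq> \<zero>\<^bsub>F\<^esub>"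
    and card: "card (carrier E) = card (carrier F) ^ 2"
    and w: "w \<in> carrier E" "w \<otimes>\<^bsub>E\<^esub> (w \<otimes>\<^bsub>E\<^esub> w) = \<one>\<^bsub>E\<^esub>"
      "\<one>\<^bsub>E\<^esub> \<oplus>\<^bsub>E\<^esub> w \<oplus>\<^bsub>E\<^esub> w \<otimes>\<^bsub>E\<^esub> w = \<zero>\<^bsub>E\<^esub>" "w \<notin> h ` carrier F"
  shows "units_of (group_algebra F C3Q8) \<cong>
    group_power (integer_mod_group (card (carrier F) - 1)) 4 \<times>\<times>
    group_power (integer_mod_group (card (carrier E) - 1)) 4 \<times>\<times> GL 2 F \<times>\<times> GL 2 E"
proof -
  interpret F: quat_field F u v by fact
  interpret E: quat_field E u' v' by fact
  interpret ring_hom_cring F E h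
    using h by (intro ring_hom_cring.intro ring_hom_cring_axioms.intro F.is_cring E.is_cring)
  define H where "H f = (\<lambda>x\<in>carrier C3Q8. h (f x))" for f :: "int \<times> int_quat \<Rightarrow> _"
  define \<phi> where "\<phi> f = (quat_map F u v \<one>\<^bsub>F\<^esub> f, quat_map E u' v' w (H f))" for f
  let ?T = "quat_target F \<times>\<times> quat_target E"
  have H_mem: "H f \<in> carrier E.A" if "f \<in> carrier F.A" for f
    using that by (auto simp: H_def carrier_group_algebra)
  have inj: "inj_on \<phi> (carrier F.A)"
  proof (rule inj_onI)
    fix f g assume f: "f \<in> carrier F.A" and g: "g \<in> carrier F.A" and eq: "\<phi> f = \<phi> g"
    show "f = g"
    proof (rule group_algebra_C3Q8_eqI[OF f g])
      fix x assume x: "x \<in> carrier Q8"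
      have cx: "(c, x) \<in> carrier C3Q8" if "c \<in> {0, 1, 2}" for c
        using x that by (simp add: carrier_C3)
      have fg: "f (c, x) \<in> carrier F" "g (c, x) \<in> carrier F" if "c \<in> {0, 1, 2}" for c
        using F.group_algebra_mem[OF f] F.group_algebra_mem[OF g] cx[OF that] by blast+
      define d where "d c = f (c, x) \<ominus>\<^bsub>F\<^esub> g (c, x)" for c
      have d: "d 0 \<in> carrier F" "d 1 \<in> carrier F" "d 2 \<in> carrier F"
        using fg by (simp_all add: d_def)
      have hd: "H f (c, x) \<ominus>\<^bsub>E\<^esub> H g (c, x) = h (d c)" if "c \<in> {0, 1, 2}" for c
        using fg[OF that] cx[OF that] by (simp add: H_def d_def F.minus_eq E.minus_eq)
      have "d 0 \<oplus>\<^bsub>F\<^esub> (d 1 \<otimes>\<^bsub>F\<^esub> \<one>\<^bsub>F\<^esub> \<oplus>\<^bsub>F\<^esub> d 2 \<otimes>\<^bsub>F\<^esub> (\<one>\<^bsub>F\<^esub> \<otimes>\<^bsub>F\<^esub> \<one>\<^bsub>F\<^esub>)) = \<zero>\<^bsub>F\<^esub>"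
        unfolding d_def using eq by (intro F.quat_map_eqD[OF _ f g _ x]) (simp_all add: \<phi>_def)
      moreover have "h (d 0) \<oplus>\<^bsub>E\<^esub> (h (d 1) \<otimes>\<^bsub>E\<^esub> w \<oplus>\<^bsub>E\<^esub> h (d 2) \<otimes>\<^bsub>E\<^esub> (w \<otimes>\<^bsub>E\<^esub> w)) = \<zero>\<^bsub>E\<^esub>"
        using E.quat_map_eqD[OF w(1) H_mem[OF f] H_mem[OF g] _ x] eq by (simp add: hd \<phi>_def)
      then have d02: "d 0 = d 2" and d12: "d 1 = d 2"
        using quadratic_relation_kernel[OF F.field_axioms E.field_axioms h w(1,3,4) d] by auto
      \<comment> \<open>With all three coefficients equal, the equation of the trivial character
        becomes 3 \<open>d 2\<close> = 0.\<close>
      ultimately have "(\<one>\<^bsub>F\<^esub> \<oplus>\<^bsub>F\<^esub> \<one>\<^bsub>F\<^esub> \<oplus>\<^bsub>F\<^esub> \<one>\<^bsub>F\<^esub>) \<otimes>\<^bsub>F\<^esub> d 2 = \<zero>\<^bsub>F\<^esub>"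
        using d by (simp add: F.l_distr F.a_assoc)
      then have "d 2 = \<zero>\<^bsub>F\<^esub>"
        using three d F.integral by blast
      with d02 d12 have "d 0 = \<zero>\<^bsub>F\<^esub>" "d 1 = \<zero>\<^bsub>F\<^esub>" "d 2 = \<zero>\<^bsub>F\<^esub>"
        by simp_all
      then show "f (0, x) = g (0, x) \<and> f (1, x) = g (1, x) \<and> f (2, x) = g (2, x)"
        using fg by (simp add: d_def)
    qed
  qed
  have image: "\<phi> ` carrier F.A \<subseteq> carrier ?T"
    using F.quat_map_closed[OF F.one_closed] E.quat_map_closed[OF w(1) H_mem] by (auto simp: \<phi>_def)
  have T_card: "card (carrier ?T) \<le> card (carrier F.A)"
  proof -
    have "card (carrier ?T) \<le> card (carrier F) ^ 8 * card (carrier E) ^ 8"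
      using card_quat_target_le(2)[OF F.finite_carrier] card_quat_target_le(2)[OF E.finite_carrier]
      by (simp add: card_cartesian_product mult_le_mono)
    then show ?thesis
      by (simp add: card_group_algebra_C3Q8 card flip: power_mult power_add)
  qed
  have "finite (carrier ?T)"
    using card_quat_target_le(1)[OF F.finite_carrier] card_quat_target_le(1)[OF E.finite_carrier] by simp
  with inj image T_card have bij: "bij_betw \<phi> (carrier F.A) (carrier ?T)"
    by (intro bij_betw_if_card_le)
  have "\<phi> (f \<otimes>\<^bsub>F.A\<^esub> g) = \<phi> f \<otimes>\<^bsub>?T\<^esub> \<phi> g" if "f \<in> carrier F.A" "g \<in> carrier F.A" for f g
  proof -
    have "H (f \<otimes>\<^bsub>F.A\<^esub> g) = H f \<otimes>\<^bsub>E.A\<^esub> H g"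
      unfolding H_def by (rule group_algebra_map_mult[OF ring_hom_cring_axioms group_C3Q8 that])
    then show ?thesis
      using F.quat_map_mult[OF F.one_closed _ that] E.quat_map_mult[OF w(1,2) H_mem H_mem] that
      by (simp add: \<phi>_def)
  qed
  then have iso: "\<phi> \<in> iso F.A ?T"
    using bij by (intro isoI homI bij_betw_apply[OF bij])
  have one: "\<phi> \<one>\<^bsub>F.A\<^esub> = \<one>\<^bsub>?T\<^esub>"
  proof -
    have "H \<one>\<^bsub>F.A\<^esub> = \<one>\<^bsub>E.A\<^esub>"
      by (auto simp: H_def one_group_algebra intro!: restrict_ext)
    then show ?thesis
      using F.quat_map_one[OF F.one_closed] E.quat_map_one[OF w(1)] by (simp add: \<phi>_def)
  qed
  have "units_of F.A \<cong> units_of ?T"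
    by (rule units_of_cong[OF iso]) (auto simp: one intro: F.one_group_algebra_closed F.group_algebra_closed)
  also have "units_of ?T = units_of (quat_target F) \<times>\<times> units_of (quat_target E)"
    by (rule units_of_DirProd)
  also have "\<dots> \<cong> (group_power (integer_mod_group (card (carrier F) - 1)) 4 \<times>\<times> GL 2 F) \<times>\<times>
      (group_power (integer_mod_group (card (carrier E) - 1)) 4 \<times>\<times> GL 2 E)"
    by (rule DirProd_cong[OF F.units_of_quat_target E.units_of_quat_target])
  also have "\<dots> \<cong> group_power (integer_mod_group (card (carrier F) - 1)) 4 \<times>\<times>
      group_power (integer_mod_group (card (carrier E) - 1)) 4 \<times>\<times> GL 2 F \<times>\<times> GL 2 E"
    by (rule DirProd_interchange)
  finally show ?thesis .
qed

section \<open>Choice of the parameters and the two congruence cases\<close>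

lemma (in finite_field) quat_field_exists:
  assumes "\<one> \<oplus> \<one> \<noteq> \<zero>"
  obtains u v where "quat_field R u v"
proof -
  obtain u v where "u \<in> carrier R" "v \<in> carrier R" "u \<otimes> u \<oplus> v \<otimes> v = \<ominus> \<one>"
    by (rule minus_one_sum_of_squares)
  then have "quat_field R u v"
    using assms finite_field_axioms by (simp add: quat_field_def quat_field_axioms_def)
  then show ?thesis
    by (rule that)
qed

theorem theorem2p11:
  fixes F :: "('a, 'm) ring_scheme" and p k q :: nat
  assumes "field F" and "finite (carrier F)"
    and "ring_char F = p"
    and "card (carrier F) = q" and "q = p ^ k"
    and "p > 3"
  shows "([int q = 1] (mod 12) \<or> [int q = -5] (mod 12) \<longrightarrow>
           units_of (group_algebra F (integer_mod_group 3 \<times>\<times> Q8)) \<cong>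
             group_power (integer_mod_group (p ^ k - 1)) 12 \<times>\<times> group_power (GL 2 F) 3)
       \<and> ([int q = -1] (mod 12) \<or> [int q = 5] (mod 12) \<longrightarrow>
           (\<forall>F2 :: ('b, 'n) ring_scheme. field_extension_of_degree 2 F F2 \<longrightarrow>
             units_of (group_algebra F (integer_mod_group 3 \<times>\<times> Q8)) \<cong>
               group_power (integer_mod_group (p ^ k - 1)) 4 \<times>\<times>
               group_power (integer_mod_group (p ^ (2 * k) - 1)) 4 \<times>\<times> GL 2 F \<times>\<times> GL 2 F2))"
proof (intro conjI impI allI)
  interpret F: finite_field F
    using assms(1,2) by (simp add: finite_field_def finite_field_axioms_def)
  have two: "\<one>\<^bsub>F\<^esub> \<oplus>\<^bsub>F\<^esub> \<one>\<^bsub>F\<^esub> \<noteq> \<zero>\<^bsub>F\<^esub>"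
    and three: "\<one>\<^bsub>F\<^esub> \<oplus>\<^bsub>F\<^esub> \<one>\<^bsub>F\<^esub> \<oplus>\<^bsub>F\<^esub> \<one>\<^bsub>F\<^esub> \<noteq> \<zero>\<^bsub>F\<^esub>"
    using F.two_three_neq_zero assms(3,6) by simp_all
  obtain u v where quat: "quat_field F u v"
    using F.quat_field_exists[OF two] .
  have q: "card (carrier F) = p ^ k" "int q mod 12 = int (q mod 12)"
    using assms(4,5) by (simp_all add: zmod_int)
  {
    assume "[int q = 1] (mod 12) \<or> [int q = -5] (mod 12)"
    then have "q mod 12 = 1 \<or> q mod 12 = 7"
      by (auto simp: cong_def q(2))
    then have "3 dvd q - 1"
      by presburger
    then obtain w where w: "w \<in> carrier F" "w \<noteq> \<one>\<^bsub>F\<^esub>" "w \<otimes>\<^bsub>F\<^esub> (w \<otimes>\<^bsub>F\<^esub> w) = \<one>\<^bsub>F\<^esub>"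
      "\<one>\<^bsub>F\<^esub> \<oplus>\<^bsub>F\<^esub> w \<oplus>\<^bsub>F\<^esub> w \<otimes>\<^bsub>F\<^esub> w = \<zero>\<^bsub>F\<^esub>"
      using F.primitive_cube_root_of_unity assms(4) by metis
    then show "units_of (group_algebra F (integer_mod_group 3 \<times>\<times> Q8)) \<cong>
        group_power (integer_mod_group (p ^ k - 1)) 12 \<times>\<times> group_power (GL 2 F) 3"
      using quat_field.units_of_group_algebra_split[OF quat three] unfolding q(1) by blast
  next
    fix F2 :: "('b, 'n) ring_scheme"
    assume "[int q = -1] (mod 12) \<or> [int q = 5] (mod 12)" and F2: "field_extension_of_degree 2 F F2"
    then have "q mod 12 = 11 \<or> q mod 12 = 5"
      by (auto simp: cong_def q(2))
    then have q_mod: "q mod 3 = 2"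
      by presburger
    then have not_dvd: "\<not> 3 dvd q - 1"
      by presburger
    \<comment> \<open>q is 2 modulo 3, so q^2 is 1 modulo 3: a primitive cube root of unity is
      missing in F but present in F_2.\<close>
    have "q ^ 2 mod 3 = 1"
      using q_mod by (simp add: power2_eq_square mod_mult_eq[of q 3 q, symmetric])
    then have dvd: "3 dvd q ^ 2 - 1"
      by presburger
    have card: "finite (carrier F2)" "card (carrier F2) = card (carrier F) ^ 2"
      using card_field_extension_of_degree[OF assms(1,2) F2] by simp_all
    obtain h where "field F2" and h: "h \<in> Ring.ring_hom F F2"
      using F2 by (auto simp: field_extension_of_degree_def)
    then interpret E: finite_field F2
      using card by (simp add: finite_field_def finite_field_axioms_def)
    interpret ring_hom_cring F F2 h
      using h by (intro ring_hom_cring.intro ring_hom_cring_axioms.intro F.is_cring E.is_cring)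
    have inj: "inj_on h (carrier F)"
      using non_trivial_field_hom_is_inj[OF h F.field_axioms E.field_axioms] .
    have "h (\<one>\<^bsub>F\<^esub> \<oplus>\<^bsub>F\<^esub> \<one>\<^bsub>F\<^esub>) \<noteq> h \<zero>\<^bsub>F\<^esub>"
      using two inj by (subst inj_on_eq_iff[OF inj]) simp_all
    then have "\<one>\<^bsub>F2\<^esub> \<oplus>\<^bsub>F2\<^esub> \<one>\<^bsub>F2\<^esub> \<noteq> \<zero>\<^bsub>F2\<^esub>"
      by simp
    then obtain u' v' where quat': "quat_field F2 u' v'"
      by (rule E.quat_field_exists)
    obtain w where w: "w \<in> carrier F2" "w \<noteq> \<one>\<^bsub>F2\<^esub>" "w \<otimes>\<^bsub>F2\<^esub> (w \<otimes>\<^bsub>F2\<^esub> w) = \<one>\<^bsub>F2\<^esub>"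
      "\<one>\<^bsub>F2\<^esub> \<oplus>\<^bsub>F2\<^esub> w \<oplus>\<^bsub>F2\<^esub> w \<otimes>\<^bsub>F2\<^esub> w = \<zero>\<^bsub>F2\<^esub>"
      using E.primitive_cube_root_of_unity dvd card(2) assms(4) by metis
    \<comment> \<open>A preimage of w would be a cube root of unity in F, hence 1, whereas w differs
      from 1.\<close>
    have w_notin: "w \<notin> h ` carrier F"
    proof
      assume "w \<in> h ` carrier F"
      then obtain a where a: "a \<in> carrier F" "w = h a"
        by blast
      then have "h (a \<otimes>\<^bsub>F\<^esub> (a \<otimes>\<^bsub>F\<^esub> a)) = h \<one>\<^bsub>F\<^esub>"
        using w(3) by simp
      then have "a \<otimes>\<^bsub>F\<^esub> (a \<otimes>\<^bsub>F\<^esub> a) = \<one>\<^bsub>F\<^esub>"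
        using inj_onD[OF inj] a(1) by simp
      then have "a = \<one>\<^bsub>F\<^esub>"
        using F.cube_root_of_unity_trivial not_dvd a(1) assms(4) by blast
      then show False
        using a(2) w(2) by simp
    qed
    have "card (carrier F2) = p ^ (2 * k)"
      by (simp add: card(2) q(1) power_mult[symmetric] mult.commute)
    then show "units_of (group_algebra F (integer_mod_group 3 \<times>\<times> Q8)) \<cong>
        group_power (integer_mod_group (p ^ k - 1)) 4 \<times>\<times>
        group_power (integer_mod_group (p ^ (2 * k) - 1)) 4 \<times>\<times> GL 2 F \<times>\<times> GL 2 F2"
      using units_of_group_algebra_nonsplit[OF quat quat' h three card(2) w(1,3,4) w_notin]
      unfolding q(1) by simp
  }
qed

end
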